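(* Let $s\ge 1$ be an integer and let $G$ be a countable group. Then $G$ admits a polynomial sofic approximation of degree $\le s$ if and only if $G$ is sofic.
   Context: For groups $G,H$, a map $f:G\to H$ and $g\in G$, define $\partial_g f:G\to H$ by $(\partial_g f)(x)=f(gx)f(x)^{-1}$, and put $\partial_{g_1,\ldots,g_k}f=\partial_{g_1}(\partial_{g_2}(\cdots\partial_{g_k}f))$. $\mathrm{Sym}(n)$ carries the normalized Hamming distance $d_n(\sigma,\tau)=1-\frac1n|\mathrm{Fix}(\sigma^{-1}\tau)|$. A sequence of maps $f_n:G\to\mathrm{Sym}(m_n)$ ($m_n$ positive integers) is asymptotically unital if $\lim_n d_{m_n}(f_n(1),1)=0$. An asymptotically unital sequence is almost-polynomial of degree $\le s$ if $\lim_n d_{m_n}((\partial_{g_1,\ldots,g_{s+1}}f_n)(1),1)=0$ for all $g_1,\ldots,g_{s+1}\in G$. A polynomial sofic approximation of $G$ of degree $\le s$ is an almost-polynomial sequence $(f_n)_n$ of degree $\le s$ of $G$ such that $\lim_n d_{m_n}(f_n(g),\mathrm{id})=1$ for all $g\in G\setminus\{1\}$. A countable group $G$ is sofic if there is a sequence of maps $f_n:G\to\mathrm{Sym}(m_n)$ with $\lim_n d_{m_n}(f_n(gh),f_n(g)f_n(h))=0$ for all $g,h\in G$ and $\lim_n d_{m_n}(f_n(g),\mathrm{id})=1$ for every $g\ne1$. *)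

theory Defs
  imports "HOL-Analysis.Analysis" "HOL-Algebra.Sym_Groups"
begin

definition mderiv ::
    "('a, 'm) monoid_scheme \<Rightarrow> ('b, 'k) monoid_scheme \<Rightarrow> 'a \<Rightarrow> ('a \<Rightarrow> 'b) \<Rightarrow> 'a \<Rightarrow> 'b"
  where "mderiv G H g f = (\<lambda>x. f (g \<otimes>\<^bsub>G\<^esub> x) \<otimes>\<^bsub>H\<^esub> inv\<^bsub>H\<^esub> (f x))"

text \<open>The head of the list is the outermost derivative: \<open>mderivs G H [g\<^sub>1, \<dots>, g\<^sub>k] f\<close> is
  \<open>mderiv G H g\<^sub>1 (\<dots> (mderiv G H g\<^sub>k f))\<close>.\<close>

definition mderivs ::
    "('a, 'm) monoid_scheme \<Rightarrow> ('b, 'k) monoid_scheme \<Rightarrow> 'a list \<Rightarrow> ('a \<Rightarrow> 'b) \<Rightarrow> 'a \<Rightarrow> 'b"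
  where "mderivs G H gs f = foldr (mderiv G H) gs f"

text \<open>The symmetric group of degree \<open>n\<close> is the library's \<^const>\<open>sym_group\<close>, acting on \<open>{1..n}\<close>;
  its elements are functions on all of \<^typ>\<open>nat\<close> that fix every point outside \<open>{1..n}\<close>, so fixed
  points are counted in \<open>{1..n}\<close> only.\<close>

definition hamming_dist :: "nat \<Rightarrow> (nat \<Rightarrow> nat) \<Rightarrow> (nat \<Rightarrow> nat) \<Rightarrow> real"
  where "hamming_dist n \<sigma> \<tau> =
    1 - 1 / real n *
      real (card {i \<in> {1..n}. (inv\<^bsub>sym_group n\<^esub> \<sigma> \<otimes>\<^bsub>sym_group n\<^esub> \<tau>) i = i})"

definition sym_map_seq ::
    "('a, 'm) monoid_scheme \<Rightarrow> (nat \<Rightarrow> nat) \<Rightarrow> (nat \<Rightarrow> 'a \<Rightarrow> nat \<Rightarrow> nat) \<Rightarrow> bool"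
  where "sym_map_seq G m f \<longleftrightarrow>
    (\<forall>n. m n > 0 \<and> f n \<in> carrier G \<rightarrow> carrier (sym_group (m n)))"

definition asymptotically_unital ::
    "('a, 'm) monoid_scheme \<Rightarrow> (nat \<Rightarrow> nat) \<Rightarrow> (nat \<Rightarrow> 'a \<Rightarrow> nat \<Rightarrow> nat) \<Rightarrow> bool"
  where "asymptotically_unital G m f \<longleftrightarrow>
    sym_map_seq G m f \<and>
    (\<lambda>n. hamming_dist (m n) (f n \<one>\<^bsub>G\<^esub>) \<one>\<^bsub>sym_group (m n)\<^esub>) \<longlonglongrightarrow> 0"

definition almost_polynomial ::
    "('a, 'm) monoid_scheme \<Rightarrow> nat \<Rightarrow> (nat \<Rightarrow> nat) \<Rightarrow> (nat \<Rightarrow> 'a \<Rightarrow> nat \<Rightarrow> nat) \<Rightarrow> bool"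
  where "almost_polynomial G s m f \<longleftrightarrow>
    asymptotically_unital G m f \<and>
    (\<forall>gs. set gs \<subseteq> carrier G \<and> length gs = s + 1 \<longrightarrow>
      (\<lambda>n. hamming_dist (m n) (mderivs G (sym_group (m n)) gs (f n) \<one>\<^bsub>G\<^esub>)
             \<one>\<^bsub>sym_group (m n)\<^esub>) \<longlonglongrightarrow> 0)"

definition polynomial_sofic_approximation ::
    "('a, 'm) monoid_scheme \<Rightarrow> nat \<Rightarrow> (nat \<Rightarrow> nat) \<Rightarrow> (nat \<Rightarrow> 'a \<Rightarrow> nat \<Rightarrow> nat) \<Rightarrow> bool"
  where "polynomial_sofic_approximation G s m f \<longleftrightarrow>
    almost_polynomial G s m f \<and>
    (\<forall>g \<in> carrier G - {\<one>\<^bsub>G\<^esub>}.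
      (\<lambda>n. hamming_dist (m n) (f n g) \<one>\<^bsub>sym_group (m n)\<^esub>) \<longlonglongrightarrow> 1)"

definition sofic :: "('a, 'm) monoid_scheme \<Rightarrow> bool"
  where "sofic G \<longleftrightarrow>
    (\<exists>m f. sym_map_seq G m f \<and>
      (\<forall>g \<in> carrier G. \<forall>h \<in> carrier G.
        (\<lambda>n. hamming_dist (m n) (f n (g \<otimes>\<^bsub>G\<^esub> h)) (f n g \<otimes>\<^bsub>sym_group (m n)\<^esub> f n h))
          \<longlonglongrightarrow> 0) \<and>
      (\<forall>g \<in> carrier G - {\<one>\<^bsub>G\<^esub>}.
        (\<lambda>n. hamming_dist (m n) (f n g) \<one>\<^bsub>sym_group (m n)\<^esub>) \<longlonglongrightarrow> 1))"

end

theory Submission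
  imports Defs "HOL-Algebra.Product_Groups" "HOL-Algebra.FiniteProduct" "HOL-Real_Asymp.Real_Asymp"
begin

text \<open>An almost-polynomial sequence of degree \<open>\<le> s\<close> is a genuine polynomial map \<open>f\<close> of degree \<open>\<le> s\<close>
  from \<open>G\<close> into the group of sequences of permutations modulo those converging to the identity.
  Such an \<open>f\<close>, if unital, is a homomorphism on the \<open>(s - 1)\<close>-st derived subgroup \<open>D\<close> of \<open>G\<close>, by
  induction on \<open>s\<close>: the defects \<open>f (k x) (f x)\<^sup>-\<^sup>1 (f k)\<^sup>-\<^sup>1\<close> have smaller degree in \<open>x\<close>, and as soon
  as they are homomorphisms on a subgroup their images are abelian, so they vanish on its derived
  subgroup. Hence \<open>D\<close> is sofic, and soficity climbs back up the derived series because an extension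
  of a sofic group by an abelian (so amenable) quotient is sofic. Conversely, a sofic approximation
  is a homomorphism into the quotient, which is polynomial of degree \<open>\<le> 1\<close>.\<close>

section \<open>Polynomial maps between groups\<close>

lemma mderivs_Nil [simp]: "mderivs G H [] f = f"
  by (simp add: mderivs_def)

lemma mderivs_Cons [simp]: "mderivs G H (g # gs) f = mderiv G H g (mderivs G H gs f)"
  by (simp add: mderivs_def)

lemma mderivs_append: "mderivs G H (gs @ hs) f = mderivs G H gs (mderivs G H hs f)"
  by (simp add: mderivs_def)

lemma mderiv_closed:
  assumes "group G" "group H" "g \<in> carrier G" "f \<in> carrier G \<rightarrow> carrier H"
  shows "mderiv G H g f \<in> carrier G \<rightarrow> carrier H"
proof -
  interpret G: group G by fact
  interpret H: group H by fact
  show ?thesis using assms(3,4) by (auto simp: mderiv_def)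
qed

lemma mderivs_closed:
  assumes "group G" "group H" "set gs \<subseteq> carrier G" "f \<in> carrier G \<rightarrow> carrier H"
  shows "mderivs G H gs f \<in> carrier G \<rightarrow> carrier H"
  using assms(3) by (induction gs) (simp_all add: assms mderiv_closed)

text \<open>A derivative is a group word in values of \<open>f\<close>, so it commutes with
  homomorphisms of the target. This is applied to the projection onto the quotient by null sequences
  and to each coordinate projection of the product.\<close>

lemma mderivs_hom:
  assumes "group G" "group H" "group K" "q \<in> hom H K" "set gs \<subseteq> carrier G"
    and "f \<in> carrier G \<rightarrow> carrier H" "x \<in> carrier G"
  shows "q (mderivs G H gs f x) = mderivs G K gs (\<lambda>y. q (f y)) x"
  using assms(5,7)
proof (induction gs arbitrary: x)
  case (Cons g gs)
  interpret G: group G by fact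
  interpret q: group_hom H K q
    using assms by (simp add: group_hom_def group_hom_axioms_def)
  have "mderivs G H gs f y \<in> carrier H" if "y \<in> carrier G" for y
    using mderivs_closed[OF assms(1,2) _ assms(6), of gs] Cons.prems(1) that by auto
  then show ?case
    using Cons by (simp add: mderiv_def)
qed simp

lemma mderivs_cong:
  assumes "group G" "set gs \<subseteq> carrier G" "\<And>x. x \<in> carrier G \<Longrightarrow> f x = f' x" "x \<in> carrier G"
  shows "mderivs G H gs f x = mderivs G H gs f' x"
  using assms(2,4)
proof (induction gs arbitrary: x)
  case (Cons g gs)
  interpret G: group G by fact
  show ?case using Cons by (simp add: mderiv_def)
qed (use assms in simp)

text \<open>The constant stands on the right and therefore cancels against its own inverse. It lets
  a derivative ignore the normalising factor in \<open>hom_defect\<close>.\<close>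

lemma mderiv_mult_const:
  assumes "group G" "group H" "g \<in> carrier G" "x \<in> carrier G" "f \<in> carrier G \<rightarrow> carrier H" "c \<in> carrier H"
  shows "mderiv G H g (\<lambda>y. f y \<otimes>\<^bsub>H\<^esub> c) x = mderiv G H g f x"
proof -
  interpret G: group G by fact
  interpret H: group H by fact
  have "f x \<in> carrier H" "f (g \<otimes>\<^bsub>G\<^esub> x) \<in> carrier H" using assms(3-5) by auto
  then show ?thesis
    using assms(6) H.inv_solve_right' by (simp add: mderiv_def H.inv_mult_group H.m_assoc flip: H.m_assoc[of c "inv\<^bsub>H\<^esub> c"])
qed

text \<open>Testing at the identity alone loses nothing: letting the outermost increment vary shows
  that every derivative of order \<open>s\<close> is constant, so those of order
  \<open>s + 1\<close> are trivial everywhere.\<close>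

definition polynomial_map ::
    "('a, 'm) monoid_scheme \<Rightarrow> ('b, 'k) monoid_scheme \<Rightarrow> nat \<Rightarrow> ('a \<Rightarrow> 'b) \<Rightarrow> bool"
  where "polynomial_map G H s f \<longleftrightarrow> f \<in> carrier G \<rightarrow> carrier H \<and>
    (\<forall>gs. set gs \<subseteq> carrier G \<and> length gs = s + 1 \<longrightarrow> mderivs G H gs f \<one>\<^bsub>G\<^esub> = \<one>\<^bsub>H\<^esub>)"

text \<open>When \<open>f\<close> is unital, its second derivative along \<open>[y, x]\<close> at
  the identity is \<open>f (x y)\<close> times the inverses of \<open>f y\<close> and
  \<open>f x\<close>, so its vanishing is multiplicativity. This is the base case of the induction
  on the degree.\<close>

lemma polynomial_map_degree_one:
  assumes "group G" "group H" "polynomial_map G H 1 f" "f \<one>\<^bsub>G\<^esub> = \<one>\<^bsub>H\<^esub>"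
  shows "f \<in> hom G H"
proof (rule homI)
  interpret G: group G by fact
  interpret H: group H by fact
  show f: "f x \<in> carrier H" if "x \<in> carrier G" for x
    using assms(3) that by (auto simp: polynomial_map_def)
  fix x y assume xy: "x \<in> carrier G" "y \<in> carrier G"
  have "mderivs G H [y, x] f \<one>\<^bsub>G\<^esub> = \<one>\<^bsub>H\<^esub>"
    using assms(3) xy unfolding polynomial_map_def by (auto simp del: mderivs_Cons)
  then have "f (x \<otimes>\<^bsub>G\<^esub> y) \<otimes>\<^bsub>H\<^esub> inv\<^bsub>H\<^esub> f y \<otimes>\<^bsub>H\<^esub> inv\<^bsub>H\<^esub> f x = \<one>\<^bsub>H\<^esub>"
    using xy assms(4) f by (simp add: mderiv_def)
  then show "f (x \<otimes>\<^bsub>G\<^esub> y) = f x \<otimes>\<^bsub>H\<^esub> f y"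
    using f xy by (simp add: H.inv_solve_right')
qed

lemma polynomial_map_hom:
  assumes "group G" "group H" "f \<in> hom G H" "1 \<le> s"
  shows "polynomial_map G H s f"
proof -
  interpret f: group_hom G H f
    using assms by (simp add: group_hom_def group_hom_axioms_def)
  \<comment> \<open>The first derivative of a homomorphism along \<open>g\<close> is the constant
    \<open>f g\<close>, and a constant has trivial derivative. Constancy has to be carried along for
    the induction over the list.\<close>
  have const: "mderivs G H gs f x = mderivs G H gs f \<one>\<^bsub>G\<^esub> \<and> (2 \<le> length gs \<longrightarrow> mderivs G H gs f \<one>\<^bsub>G\<^esub> = \<one>\<^bsub>H\<^esub>)"
    if "set gs \<subseteq> carrier G" "gs \<noteq> []" "x \<in> carrier G" for gs x
    using that
  proof (induction gs arbitrary: x)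
    case (Cons g gs)
    show ?case
    proof (cases "gs = []")
      case True
      then show ?thesis using Cons.prems by (simp add: mderiv_def f.H.m_assoc)
    next
      case False
      have "mderivs G H gs f \<in> carrier G \<rightarrow> carrier H"
        using Cons.prems(1) f.hom_closed by (intro mderivs_closed assms) auto
      then have c: "mderivs G H gs f \<one>\<^bsub>G\<^esub> \<in> carrier H"
        by auto
      moreover have "mderivs G H gs f y = mderivs G H gs f \<one>\<^bsub>G\<^esub>"
        if "y \<in> {g, x, g \<otimes>\<^bsub>G\<^esub> x}" for y
        using Cons.IH[OF _ False, of y] Cons.prems that by auto
      ultimately show ?thesis
        using Cons.prems by (simp add: mderiv_def)
    qed
  qed simp
  show ?thesis
    unfolding polynomial_map_def
  proof (intro conjI allI impI)
    fix gs assume gs: "set gs \<subseteq> carrier G \<and> length gs = s + 1"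
    then have "gs \<noteq> []" by auto
    with const[OF _ this f.G.one_closed] gs assms(4) show "mderivs G H gs f \<one>\<^bsub>G\<^esub> = \<one>\<^bsub>H\<^esub>"
      by simp
  qed (use f.hom_closed in auto)
qed

section \<open>Defects of multiplicativity and the derived series\<close>

lemma (in group_hom) abelian_image_trivial_on_derived:
  assumes "\<And>x y. x \<in> carrier G \<Longrightarrow> y \<in> carrier G \<Longrightarrow> h x \<otimes>\<^bsub>H\<^esub> h y = h y \<otimes>\<^bsub>H\<^esub> h x"
    and "x \<in> derived G (carrier G)"
  shows "h x = \<one>\<^bsub>H\<^esub>"
proof -
  have "derived_set G (carrier G) \<subseteq> kernel G H h"
  proof clarsimp
    fix a b assume ab: "a \<in> carrier G" "b \<in> carrier G"
    then have "h a \<otimes>\<^bsub>H\<^esub> h b \<otimes>\<^bsub>H\<^esub> inv\<^bsub>H\<^esub> h a \<otimes>\<^bsub>H\<^esub> inv\<^bsub>H\<^esub> h b = \<one>\<^bsub>H\<^esub>"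
      by (simp add: assms(1)[of a b] H.m_assoc flip: H.m_assoc[of "h a" "inv\<^bsub>H\<^esub> h a"])
    then show "a \<otimes> b \<otimes> inv a \<otimes> inv b \<in> kernel G H h"
      using ab by (simp add: kernel_def)
  qed
  then have "derived G (carrier G) \<subseteq> kernel G H h"
    unfolding derived_def by (rule G.generate_subgroup_incl[OF _ subgroup_kernel])
  with assms(2) show ?thesis by (auto simp: kernel_def)
qed

text \<open>The factor depending on \<open>k\<close> alone is placed on the right: there it is a
  constant that the first derivative removes, and it makes the defect of a unital map trivial at the
  identity.\<close>

definition hom_defect where
  "hom_defect G H f k x = mderiv G H k f x \<otimes>\<^bsub>H\<^esub> inv\<^bsub>H\<^esub> f k"

lemma hom_defect_eq:
  assumes "group G" "group H" "f \<in> carrier G \<rightarrow> carrier H" "k \<in> carrier G" "x \<in> carrier G"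
  shows "f (k \<otimes>\<^bsub>G\<^esub> x) = hom_defect G H f k x \<otimes>\<^bsub>H\<^esub> f k \<otimes>\<^bsub>H\<^esub> f x"
    and "hom_defect G H f k x \<in> carrier H"
proof -
  interpret G: group G by fact
  interpret H: group H by fact
  have "f x \<in> carrier H" "f (k \<otimes>\<^bsub>G\<^esub> x) \<in> carrier H" "f k \<in> carrier H" using assms(3-5) by auto
  then show "f (k \<otimes>\<^bsub>G\<^esub> x) = hom_defect G H f k x \<otimes>\<^bsub>H\<^esub> f k \<otimes>\<^bsub>H\<^esub> f x" "hom_defect G H f k x \<in> carrier H"
    by (simp_all add: hom_defect_def mderiv_def H.m_assoc)
qed

text \<open>Up to a constant right factor the defect is the derivative of \<open>f\<close> along
  \<open>k\<close>, so its derivatives are derivatives of \<open>f\<close> of one order more, with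
  \<open>k\<close> innermost.\<close>

lemma polynomial_map_hom_defect:
  assumes "group G" "group H" "polynomial_map G H (Suc (Suc s)) f" "k \<in> carrier G"
  shows "polynomial_map G H (Suc s) (hom_defect G H f k)"
proof -
  interpret G: group G by fact
  interpret H: group H by fact
  have f: "f \<in> carrier G \<rightarrow> carrier H"
    using assms(3) by (simp add: polynomial_map_def)
  have "mderivs G H gs (hom_defect G H f k) \<one>\<^bsub>G\<^esub> = \<one>\<^bsub>H\<^esub>"
    if gs: "set gs \<subseteq> carrier G" "length gs = Suc s + 1" for gs
  proof -
    \<comment> \<open>The last entry of the list is the innermost derivative, the one that absorbs
      the constant factor.\<close>
    obtain gs' g where eq: "gs = gs' @ [g]"
      using gs(2) by (metis add_eq_0_iff_both_eq_0 length_0_conv rev_exhaust zero_neq_one)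
    have "mderivs G H gs (hom_defect G H f k) \<one>\<^bsub>G\<^esub> = mderivs G H gs' (mderiv G H g (mderiv G H k f)) \<one>\<^bsub>G\<^esub>"
      using gs eq assms f mderiv_closed[OF assms(1,2,4) f]
      unfolding eq mderivs_append mderivs_Cons mderivs_Nil hom_defect_def
      by (intro mderivs_cong) (auto intro!: mderiv_mult_const)
    also have "\<dots> = mderivs G H (gs' @ [g, k]) f \<one>\<^bsub>G\<^esub>"
      by (simp add: mderivs_append)
    also have "\<dots> = \<one>\<^bsub>H\<^esub>"
      using assms(3) spec[of _ "gs' @ [g, k]"] \<open>k \<in> carrier G\<close> gs eq
      by (simp add: polynomial_map_def)
    finally show ?thesis .
  qed
  moreover have "hom_defect G H f k \<in> carrier G \<rightarrow> carrier H"
    using hom_defect_eq(2)[OF assms(1,2) f assms(4)] by auto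
  ultimately show ?thesis by (simp add: polynomial_map_def)
qed

text \<open>Evaluating \<open>f (k \<otimes> (inv k \<otimes> x))\<close> shows that the inverse of \<open>hom_defect G H f k x\<close> is
  conjugate to \<open>hom_defect G H f (inv k) x\<close>, by an element independent of \<open>x\<close>. So pointwise
  inversion preserves multiplicativity and the image is abelian.\<close>

lemma hom_defect_commute:
  assumes "group G" "group H" "f \<in> carrier G \<rightarrow> carrier H" "f \<one>\<^bsub>G\<^esub> = \<one>\<^bsub>H\<^esub>"
    and hom: "\<And>k. k \<in> carrier G \<Longrightarrow> hom_defect G H f k \<in> hom G H"
    and "k \<in> carrier G" "x \<in> carrier G" "y \<in> carrier G"
  shows "hom_defect G H f k x \<otimes>\<^bsub>H\<^esub> hom_defect G H f k y = hom_defect G H f k y \<otimes>\<^bsub>H\<^esub> hom_defect G H f k x"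
proof -
  interpret G: group G by fact
  interpret H: group H by fact
  note f = assms(3)
  let ?\<phi> = "hom_defect G H f"
  define l where "l = inv\<^bsub>G\<^esub> k"
  have l: "l \<in> carrier G" "k \<otimes>\<^bsub>G\<^esub> l = \<one>\<^bsub>G\<^esub>" using assms(6) by (auto simp: l_def)
  have fc: "f z \<in> carrier H" if "z \<in> carrier G" for z using f that by auto
  have c: "?\<phi> j z \<in> carrier H" if "j \<in> carrier G" "z \<in> carrier G" for j z
    using hom_defect_eq(2)[OF assms(1,2) f that] .
  have inv: "inv\<^bsub>H\<^esub> ?\<phi> k z = f k \<otimes>\<^bsub>H\<^esub> ?\<phi> l z \<otimes>\<^bsub>H\<^esub> inv\<^bsub>H\<^esub> f k" if z: "z \<in> carrier G" for z
  proof -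
    have "\<one>\<^bsub>H\<^esub> = ?\<phi> k l \<otimes>\<^bsub>H\<^esub> f k \<otimes>\<^bsub>H\<^esub> f l"
      using hom_defect_eq(1)[OF assms(1,2) f assms(6) l(1)] l assms(4) by simp
    \<comment> \<open>The relation \<open>k l = 1\<close> ties the constant
      \<open>?\<phi> k l\<close> to \<open>f l\<close>, so that both can be cancelled from the
      identity obtained next.\<close>
    then have fl: "?\<phi> k l \<otimes>\<^bsub>H\<^esub> f k = inv\<^bsub>H\<^esub> f l"
      using fc c l assms(6) H.inv_equality H.m_closed by metis
    have "f z = f (k \<otimes>\<^bsub>G\<^esub> (l \<otimes>\<^bsub>G\<^esub> z))"
      using l assms(6) z by (simp flip: G.m_assoc)
    also have "\<dots> = ?\<phi> k (l \<otimes>\<^bsub>G\<^esub> z) \<otimes>\<^bsub>H\<^esub> f k \<otimes>\<^bsub>H\<^esub> f (l \<otimes>\<^bsub>G\<^esub> z)"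
      using hom_defect_eq(1)[OF assms(1,2) f] l assms(6) z by simp
    also have "\<dots> = ?\<phi> k l \<otimes>\<^bsub>H\<^esub> ?\<phi> k z \<otimes>\<^bsub>H\<^esub> f k \<otimes>\<^bsub>H\<^esub> (?\<phi> l z \<otimes>\<^bsub>H\<^esub> f l \<otimes>\<^bsub>H\<^esub> f z)"
      using hom_defect_eq(1)[OF assms(1,2) f] hom_mult[OF hom] l assms(6) z by simp
    finally have "?\<phi> k l \<otimes>\<^bsub>H\<^esub> (?\<phi> k z \<otimes>\<^bsub>H\<^esub> f k \<otimes>\<^bsub>H\<^esub> ?\<phi> l z) \<otimes>\<^bsub>H\<^esub> f l \<otimes>\<^bsub>H\<^esub> f z = \<one>\<^bsub>H\<^esub> \<otimes>\<^bsub>H\<^esub> f z"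
      using fc c l assms(6) z by (simp add: H.m_assoc)
    then have "?\<phi> k l \<otimes>\<^bsub>H\<^esub> (?\<phi> k z \<otimes>\<^bsub>H\<^esub> f k \<otimes>\<^bsub>H\<^esub> ?\<phi> l z) \<otimes>\<^bsub>H\<^esub> f l = \<one>\<^bsub>H\<^esub>"
      using fc c l assms(6) z by (subst (asm) H.right_cancel) auto
    then have "?\<phi> k l \<otimes>\<^bsub>H\<^esub> (?\<phi> k z \<otimes>\<^bsub>H\<^esub> f k \<otimes>\<^bsub>H\<^esub> ?\<phi> l z) = ?\<phi> k l \<otimes>\<^bsub>H\<^esub> f k"
      unfolding fl using fc c l assms(6) z by (intro H.inv_equality[symmetric]) auto
    then have "?\<phi> k z \<otimes>\<^bsub>H\<^esub> (f k \<otimes>\<^bsub>H\<^esub> ?\<phi> l z) = f k"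
      using fc c l assms(6) z by (simp add: H.m_assoc)
    then have "f k \<otimes>\<^bsub>H\<^esub> ?\<phi> l z = inv\<^bsub>H\<^esub> ?\<phi> k z \<otimes>\<^bsub>H\<^esub> f k"
      using fc c l assms(6) z by (simp add: H.inv_solve_left)
    then show ?thesis
      using fc c l assms(6) z by (simp add: H.m_assoc)
  qed
  have "inv\<^bsub>H\<^esub> ?\<phi> k (x \<otimes>\<^bsub>G\<^esub> y) = inv\<^bsub>H\<^esub> ?\<phi> k x \<otimes>\<^bsub>H\<^esub> inv\<^bsub>H\<^esub> ?\<phi> k y"
    using fc c l assms(6-) hom_mult[OF hom[OF l(1)]]
    by (simp add: inv H.m_assoc flip: H.m_assoc[of "inv\<^bsub>H\<^esub> f k" "f k"])
  then have "inv\<^bsub>H\<^esub> (?\<phi> k x \<otimes>\<^bsub>H\<^esub> ?\<phi> k y) = inv\<^bsub>H\<^esub> (?\<phi> k y \<otimes>\<^bsub>H\<^esub> ?\<phi> k x)"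
    using c assms(6-) hom_mult[OF hom] by (simp add: H.inv_mult_group)
  then show ?thesis
    using c assms(6-) by (metis H.inv_inv H.m_closed)
qed

theorem polynomial_map_hom_on_derived:
  assumes "group G" "group H" "polynomial_map G H (Suc s) f" "f \<one>\<^bsub>G\<^esub> = \<one>\<^bsub>H\<^esub>"
  shows "f \<in> hom (G\<lparr>carrier := (derived G ^^ s) (carrier G)\<rparr>) H"
  using assms(3,4)
proof (induction s arbitrary: f)
  case 0
  then show ?case
    using polynomial_map_degree_one[OF assms(1,2)] by simp
next
  case (Suc s)
  interpret G: group G by fact
  interpret H: group H by fact
  \<comment> \<open>The induction hypothesis makes defects multiplicative on this subgroup. It is
    also viewed as a group \<open>K\<close> of its own, so that the results on defects can be used
    with \<open>K\<close> in place of \<open>G\<close>.\<close>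
  define D where "D = (derived G ^^ s) (carrier G)"
  define K where "K = G\<lparr>carrier := D\<rparr>"
  have D: "subgroup D G"
    unfolding D_def by (rule G.exp_of_derived_is_subgroup[OF G.subgroup_self])
  then interpret K: group K
    unfolding K_def by (rule G.subgroup_imp_group)
  have D_sub: "D \<subseteq> carrier G" using D subgroup.subset by blast
  have derived_K: "derived K (carrier K) = derived G D"
    unfolding K_def using G.derived_consistent[OF _ D] by simp
  have K_simps [simp]: "carrier K = D" "\<one>\<^bsub>K\<^esub> = \<one>\<^bsub>G\<^esub>" "x \<otimes>\<^bsub>K\<^esub> y = x \<otimes>\<^bsub>G\<^esub> y" for x y
    by (simp_all add: K_def)
  have defect_K: "hom_defect K H f = hom_defect G H f"
    by (intro ext) (simp add: hom_defect_def mderiv_def)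
  have f: "f \<in> carrier G \<rightarrow> carrier H"
    using Suc.prems(1) by (simp add: polynomial_map_def)
  have fD: "f \<in> carrier K \<rightarrow> carrier H"
    using f D_sub by auto
  \<comment> \<open>The hypothesis is applied to a defect on all of \<open>G\<close>, whose degree
    is one less; only its conclusion is restricted to \<open>D\<close>.\<close>
  have hom: "hom_defect K H f k \<in> hom K H" if "k \<in> carrier K" for k
  proof -
    have k: "k \<in> carrier G" using that D_sub by auto
    then have "f k \<in> carrier H" using f by auto
    then have "hom_defect G H f k \<one>\<^bsub>G\<^esub> = \<one>\<^bsub>H\<^esub>"
      using k Suc.prems(2) by (simp add: hom_defect_def mderiv_def)
    with Suc.IH[OF polynomial_map_hom_defect[OF assms(1,2) Suc.prems(1) k]]
    show ?thesis unfolding defect_K by (simp add: K_def D_def)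
  qed
  \<comment> \<open>Only \<open>x\<close> is confined to the derived subgroup of \<open>D\<close>,
    while \<open>k\<close> runs over \<open>D\<close>: the defect at \<open>k\<close> is a
    homomorphism in \<open>x\<close> with abelian image.\<close>
  have "f (k \<otimes>\<^bsub>G\<^esub> x) = f k \<otimes>\<^bsub>H\<^esub> f x" if "k \<in> D" "x \<in> derived G D" for k x
  proof -
    have k: "k \<in> carrier K" and x: "x \<in> carrier K"
      using that G.derived_incl[OF _ D] by auto
    interpret h: group_hom K H "hom_defect K H f k"
      using hom[OF k] assms(2) K.is_group by (simp add: group_hom_def group_hom_axioms_def)
    have "hom_defect K H f k x = \<one>\<^bsub>H\<^esub>"
      using hom_defect_commute[OF K.is_group assms(2) fD _ hom k] Suc.prems(2) that derived_K
      by (intro h.abelian_image_trivial_on_derived) auto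
    then show ?thesis
      using hom_defect_eq(1)[OF K.is_group assms(2) fD k x] fD k by (auto simp: Pi_iff)
  qed
  then show ?case
    using subsetD[OF G.derived_incl[OF subset_refl D]] fD by (auto simp: hom_def simp flip: D_def)
qed

section \<open>Sequences of permutations modulo null sequences\<close>

declare sym_group_inv_equality [simp del]

text \<open>The quotient of two permutations fixes exactly the points where they agree. All later
  estimates count points of disagreement.\<close>

lemma hamming_dist_eq_card_neq:
  assumes "n > 0" "\<sigma> \<in> carrier (sym_group n)"
  shows "hamming_dist n \<sigma> \<tau> = card {i \<in> {1..n}. \<sigma> i \<noteq> \<tau> i} / n"
proof -
  interpret Sn: group "sym_group n" by (rule sym_group_is_group)
  have \<sigma>: "\<sigma> permutes {1..n}" using assms(2) by (simp add: sym_group_carrier)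
  define \<rho> where "\<rho> = inv\<^bsub>sym_group n\<^esub> \<sigma>"
  have "\<rho> \<circ> \<sigma> = id" "\<sigma> \<circ> \<rho> = id"
    using Sn.l_inv[OF assms(2)] Sn.r_inv[OF assms(2)]
    by (simp_all add: \<rho>_def sym_group_mult sym_group_one)
  then have "\<rho> (\<tau> i) = i \<longleftrightarrow> \<sigma> i = \<tau> i" for i
    by (metis comp_apply id_apply)
  then have "hamming_dist n \<sigma> \<tau> = 1 - card {i \<in> {1..n}. \<sigma> i = \<tau> i} / n"
    by (simp add: hamming_dist_def sym_group_mult flip: \<rho>_def)
  moreover have "card {i \<in> {1..n}. \<sigma> i = \<tau> i} + card {i \<in> {1..n}. \<sigma> i \<noteq> \<tau> i} = n"
    by (subst card_Un_disjoint[symmetric]) (auto intro: arg_cong[of _ _ card, of _ "{1..n}", simplified])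
  then have "real (card {i \<in> {1..n}. \<sigma> i = \<tau> i}) = n - real (card {i \<in> {1..n}. \<sigma> i \<noteq> \<tau> i})"
    by linarith
  ultimately show ?thesis using assms(1) by (simp add: field_simps)
qed

text \<open>A point fixed by both factors is fixed by the product, so the union bound
  applies.\<close>

lemma hamming_dist_one_mult_le:
  assumes "n > 0" "\<sigma> \<in> carrier (sym_group n)" "\<tau> \<in> carrier (sym_group n)"
  shows "hamming_dist n (\<sigma> \<otimes>\<^bsub>sym_group n\<^esub> \<tau>) \<one>\<^bsub>sym_group n\<^esub> \<le>
    hamming_dist n \<sigma> \<one>\<^bsub>sym_group n\<^esub> + hamming_dist n \<tau> \<one>\<^bsub>sym_group n\<^esub>"
proof -
  interpret Sn: group "sym_group n" by (rule sym_group_is_group)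
  have "card {i \<in> {1..n}. \<sigma> (\<tau> i) \<noteq> i} \<le> card ({i \<in> {1..n}. \<sigma> i \<noteq> i} \<union> {i \<in> {1..n}. \<tau> i \<noteq> i})"
    by (intro card_mono) auto
  also have "\<dots> \<le> card {i \<in> {1..n}. \<sigma> i \<noteq> i} + card {i \<in> {1..n}. \<tau> i \<noteq> i}"
    by (rule card_Un_le)
  finally have "real (card {i \<in> {1..n}. \<sigma> (\<tau> i) \<noteq> i}) \<le>
      card {i \<in> {1..n}. \<sigma> i \<noteq> i} + card {i \<in> {1..n}. \<tau> i \<noteq> i}"
    by linarith
  moreover have "\<sigma> \<otimes>\<^bsub>sym_group n\<^esub> \<tau> \<in> carrier (sym_group n)" using assms by simp
  ultimately show ?thesis
    using assms by (simp add: hamming_dist_eq_card_neq sym_group_mult sym_group_one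
        flip: add_divide_distrib) (simp add: divide_right_mono)
qed

text \<open>This is right invariance of the metric: \<open>\<tau>\<close> maps the points where
  \<open>\<sigma>\<close> and \<open>\<tau>\<close> differ bijectively onto the points moved by the
  quotient.\<close>

lemma hamming_dist_mult_inv:
  assumes "n > 0" "\<sigma> \<in> carrier (sym_group n)" "\<tau> \<in> carrier (sym_group n)"
  shows "hamming_dist n (\<sigma> \<otimes>\<^bsub>sym_group n\<^esub> inv\<^bsub>sym_group n\<^esub> \<tau>) \<one>\<^bsub>sym_group n\<^esub> = hamming_dist n \<sigma> \<tau>"
proof -
  interpret Sn: group "sym_group n" by (rule sym_group_is_group)
  define \<rho> where "\<rho> = inv\<^bsub>sym_group n\<^esub> \<tau>"
  have comp: "\<rho> \<circ> \<tau> = id" "\<tau> \<circ> \<rho> = id"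
    using Sn.l_inv[OF assms(3)] Sn.r_inv[OF assms(3)]
    by (simp_all add: \<rho>_def sym_group_mult sym_group_one)
  have \<tau>: "\<tau> permutes {1..n}" using assms(3) by (simp add: sym_group_carrier)
  have "{i \<in> {1..n}. \<sigma> (\<rho> i) \<noteq> i} = \<tau> ` {i \<in> {1..n}. \<sigma> i \<noteq> \<tau> i}"
  proof (rule equalityI; rule subsetI)
    fix i assume i: "i \<in> {i \<in> {1..n}. \<sigma> (\<rho> i) \<noteq> i}"
    then have *: "\<tau> (\<rho> i) = i" using comp(2) by (metis comp_apply id_apply)
    then have "\<rho> i \<in> {1..n}" using \<tau> i permutes_in_image by (metis (no_types, lifting) mem_Collect_eq)
    with * i show "i \<in> \<tau> ` {i \<in> {1..n}. \<sigma> i \<noteq> \<tau> i}" by (intro image_eqI[of _ _ "\<rho> i"]) auto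
  next
    fix i assume "i \<in> \<tau> ` {i \<in> {1..n}. \<sigma> i \<noteq> \<tau> i}"
    then obtain j where j: "i = \<tau> j" "j \<in> {1..n}" "\<sigma> j \<noteq> \<tau> j" by auto
    moreover have "\<rho> i = j" using comp(1) j(1) by (metis comp_apply id_apply)
    ultimately show "i \<in> {i \<in> {1..n}. \<sigma> (\<rho> i) \<noteq> i}" using \<tau> permutes_in_image[OF \<tau>, of j] by auto
  qed
  moreover have "card (\<tau> ` {i \<in> {1..n}. \<sigma> i \<noteq> \<tau> i}) = card {i \<in> {1..n}. \<sigma> i \<noteq> \<tau> i}"
    using \<tau> by (intro card_image) (metis permutes_inj inj_on_subset subset_UNIV)
  moreover have "\<sigma> \<otimes>\<^bsub>sym_group n\<^esub> \<rho> \<in> carrier (sym_group n)" using assms by (simp add: \<rho>_def)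
  ultimately show ?thesis
    using assms by (simp add: hamming_dist_eq_card_neq flip: \<rho>_def) (simp add: sym_group_mult sym_group_one)
qed

lemma hamming_dist_commute:
  assumes "n > 0" "\<sigma> \<in> carrier (sym_group n)" "\<tau> \<in> carrier (sym_group n)"
  shows "hamming_dist n \<sigma> \<tau> = hamming_dist n \<tau> \<sigma>"
proof -
  have "{i \<in> {1..n}. \<sigma> i \<noteq> \<tau> i} = {i \<in> {1..n}. \<tau> i \<noteq> \<sigma> i}" by auto
  then show ?thesis using assms by (simp add: hamming_dist_eq_card_neq)
qed

lemma hamming_dist_nonneg:
  assumes "n > 0" "\<sigma> \<in> carrier (sym_group n)"
  shows "0 \<le> hamming_dist n \<sigma> \<tau>"
  using assms by (simp add: hamming_dist_eq_card_neq)

section \<open>The product of the symmetric groups modulo null sequences\<close>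

abbreviation seq_group where
  "seq_group m \<equiv> product_group (UNIV :: nat set) (\<lambda>n. sym_group (m n))"

lemma seq_group_is_group: "group (seq_group m)"
  by (simp add: sym_group_is_group)

definition null_seqs where
  "null_seqs m = {\<sigma> \<in> carrier (seq_group m).
    (\<lambda>n. hamming_dist (m n) (\<sigma> n) \<one>\<^bsub>sym_group (m n)\<^esub>) \<longlonglongrightarrow> 0}"

text \<open>The distance to the identity is subadditive and invariant under inversion and
  conjugation. The first two properties give a subgroup, the third gives normality.\<close>

lemma null_seqs_normal:
  assumes m: "\<And>n. m n > 0"
  shows "null_seqs m \<lhd> seq_group m"
proof -
  interpret P: group "seq_group m" by (rule seq_group_is_group)
  interpret Sn: group "sym_group (m n)" for n by (rule sym_group_is_group)
  have carr: "\<sigma> \<in> carrier (seq_group m) \<longleftrightarrow> (\<forall>n. \<sigma> n \<in> carrier (sym_group (m n)))" for \<sigma>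
    by (auto simp: PiE_iff)
  have inv: "(inv\<^bsub>seq_group m\<^esub> \<sigma>) n = inv\<^bsub>sym_group (m n)\<^esub> (\<sigma> n)"
    if "\<And>n. \<sigma> n \<in> carrier (sym_group (m n))" for \<sigma> n
    using that by (subst inv_product_group) (auto simp: sym_group_is_group)
  let ?d = "\<lambda>n \<sigma>. hamming_dist (m n) \<sigma> \<one>\<^bsub>sym_group (m n)\<^esub>"
  have d_inv: "?d n (inv\<^bsub>sym_group (m n)\<^esub> \<sigma>) = ?d n \<sigma>" if "\<sigma> \<in> carrier (sym_group (m n))" for n \<sigma>
    using hamming_dist_mult_inv[OF m Sn.one_closed that] that hamming_dist_commute[OF m that Sn.one_closed]
      Sn.l_one[OF Sn.inv_closed[OF that]] by simp
  have d_conj: "?d n (\<tau> \<otimes>\<^bsub>sym_group (m n)\<^esub> \<sigma> \<otimes>\<^bsub>sym_group (m n)\<^esub> inv\<^bsub>sym_group (m n)\<^esub> \<tau>) = ?d n \<sigma>"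
    if "\<sigma> \<in> carrier (sym_group (m n))" "\<tau> \<in> carrier (sym_group (m n))" for n \<sigma> \<tau>
  proof -
    have "?d n (\<tau> \<otimes>\<^bsub>sym_group (m n)\<^esub> \<sigma> \<otimes>\<^bsub>sym_group (m n)\<^esub> inv\<^bsub>sym_group (m n)\<^esub> \<tau>) =
        hamming_dist (m n) (\<tau> \<otimes>\<^bsub>sym_group (m n)\<^esub> \<sigma>) \<tau>"
      using that m by (intro hamming_dist_mult_inv) auto
    also have "\<dots> = ?d n \<sigma>"
    proof -
      have "inj \<tau>" using that(2) by (simp add: sym_group_carrier permutes_inj)
      then have "\<tau> (\<sigma> i) = \<tau> i \<longleftrightarrow> \<sigma> i = i" for i by (simp add: inj_eq)
      moreover have "\<tau> \<otimes>\<^bsub>sym_group (m n)\<^esub> \<sigma> \<in> carrier (sym_group (m n))" using that by simp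
      ultimately show ?thesis
        using that m by (simp add: hamming_dist_eq_card_neq) (simp add: sym_group_mult sym_group_one)
    qed
    finally show ?thesis .
  qed
  have "subgroup (null_seqs m) (seq_group m)"
  proof (rule P.subgroupI)
    show "null_seqs m \<subseteq> carrier (seq_group m)" by (auto simp: null_seqs_def)
    have "\<one>\<^bsub>seq_group m\<^esub> \<in> null_seqs m"
      using P.one_closed m by (auto simp: null_seqs_def hamming_dist_eq_card_neq)
    then show "null_seqs m \<noteq> {}" by auto
    fix a assume a: "a \<in> null_seqs m"
    have "a n \<in> carrier (sym_group (m n))" for n using a carr by (auto simp: null_seqs_def)
    with a show "inv\<^bsub>seq_group m\<^esub> a \<in> null_seqs m"
      unfolding null_seqs_def mem_Collect_eq carr by (simp add: inv d_inv del: inv_product_group)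
    fix b assume b: "b \<in> null_seqs m"
    have ca: "a n \<in> carrier (sym_group (m n))" and cb: "b n \<in> carrier (sym_group (m n))" for n
      using a b carr by (auto simp: null_seqs_def)
    have lim: "(\<lambda>n. ?d n (a n) + ?d n (b n)) \<longlonglongrightarrow> 0"
      using a b by (intro tendsto_add_zero) (auto simp: null_seqs_def)
    have "norm (?d n (a n \<otimes>\<^bsub>sym_group (m n)\<^esub> b n)) \<le> ?d n (a n) + ?d n (b n)" for n
      using hamming_dist_nonneg[OF m Sn.m_closed[OF ca cb]] hamming_dist_one_mult_le[OF m ca cb] by simp
    then have "(\<lambda>n. ?d n (a n \<otimes>\<^bsub>sym_group (m n)\<^esub> b n)) \<longlonglongrightarrow> 0"
      by (intro Lim_null_comparison[OF always_eventually lim]) blast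
    then show "a \<otimes>\<^bsub>seq_group m\<^esub> b \<in> null_seqs m"
      using ca cb by (simp add: null_seqs_def)
  qed
  then show ?thesis
  proof (rule P.normal_invI)
    fix x h assume x: "x \<in> carrier (seq_group m)" and h: "h \<in> null_seqs m"
    have "h n \<in> carrier (sym_group (m n))" "x n \<in> carrier (sym_group (m n))" for n
      using x h carr by (auto simp: null_seqs_def)
    with h show "x \<otimes>\<^bsub>seq_group m\<^esub> h \<otimes>\<^bsub>seq_group m\<^esub> inv\<^bsub>seq_group m\<^esub> x \<in> null_seqs m"
      unfolding null_seqs_def mem_Collect_eq carr by (simp add: inv d_conj del: inv_product_group)
  qed
qed

text \<open>This is the metric reduced product of the symmetric groups along the cofinite filter.
  With ordinary limits in place of an ultrafilter, equations in it are exactly the limit conditions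
  in the definitions.\<close>

definition null_quotient where "null_quotient m = seq_group m Mod null_seqs m"

definition null_class where "null_class m \<sigma> = null_seqs m #>\<^bsub>seq_group m\<^esub> \<sigma>"

lemma group_hom_null_class:
  assumes "\<And>n. m n > 0"
  shows "group_hom (seq_group m) (null_quotient m) (null_class m)"
proof -
  interpret normal "null_seqs m" "seq_group m" by (rule null_seqs_normal[OF assms])
  show ?thesis
    unfolding group_hom_def group_hom_axioms_def null_quotient_def null_class_def
    using seq_group_is_group factorgroup_is_group r_coset_hom_Mod by auto
qed

text \<open>By right invariance the distance of two sequences is the distance of their quotient to
  the identity. This is the dictionary between limits and equations in the quotient group.\<close>

lemma null_class_eq_iff:
  assumes m: "\<And>n. m n > 0"
    and \<sigma>: "\<And>n. \<sigma> n \<in> carrier (sym_group (m n))" and \<tau>: "\<And>n. \<tau> n \<in> carrier (sym_group (m n))"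
  shows "null_class m \<sigma> = null_class m \<tau> \<longleftrightarrow> (\<lambda>n. hamming_dist (m n) (\<sigma> n) (\<tau> n)) \<longlonglongrightarrow> 0"
proof -
  interpret P: group "seq_group m" by (rule seq_group_is_group)
  interpret q: group_hom "seq_group m" "null_quotient m" "null_class m"
    by (rule group_hom_null_class[OF m])
  have carr: "\<sigma> \<in> carrier (seq_group m)" "\<tau> \<in> carrier (seq_group m)" using \<sigma> \<tau> by auto
  define \<rho> where "\<rho> = \<sigma> \<otimes>\<^bsub>seq_group m\<^esub> inv\<^bsub>seq_group m\<^esub> \<tau>"
  have \<rho>: "\<rho> \<in> carrier (seq_group m)" unfolding \<rho>_def using carr by (intro P.m_closed P.inv_closed)
  have sub: "subgroup (null_seqs m) (seq_group m)"
    by (rule normal_imp_subgroup[OF null_seqs_normal[OF m]])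
  have \<rho>n: "\<rho> n = \<sigma> n \<otimes>\<^bsub>sym_group (m n)\<^esub> inv\<^bsub>sym_group (m n)\<^esub> \<tau> n" for n
    unfolding \<rho>_def using carr by (subst inv_product_group) (auto simp: sym_group_is_group)
  have "null_class m \<rho> = null_class m \<sigma> \<otimes>\<^bsub>null_quotient m\<^esub> inv\<^bsub>null_quotient m\<^esub> null_class m \<tau>"
    unfolding \<rho>_def using carr by (simp del: carrier_product_group mult_product_group inv_product_group)
  then have "null_class m \<sigma> = null_class m \<tau> \<longleftrightarrow> null_class m \<rho> = \<one>\<^bsub>null_quotient m\<^esub>"
    using carr by (simp add: q.H.inv_solve_right' del: carrier_product_group)
  also have "\<dots> \<longleftrightarrow> \<rho> \<in> null_seqs m"
    unfolding null_class_def null_quotient_def one_FactGroup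
    using P.coset_join1[OF _ \<rho> sub] P.coset_join2[OF \<rho> sub] by blast
  also have "\<dots> \<longleftrightarrow> (\<lambda>n. hamming_dist (m n) (\<sigma> n) (\<tau> n)) \<longlonglongrightarrow> 0"
    using \<rho> by (simp add: null_seqs_def \<rho>n hamming_dist_mult_inv m \<sigma> \<tau> del: carrier_product_group)
  finally show ?thesis .
qed

section \<open>Approximations as maps into the quotient group\<close>

definition limit_map where
  "limit_map m f = (\<lambda>g. null_class m (\<lambda>n. f n g))"

lemma limit_map_closed:
  assumes "sym_map_seq G m f"
  shows "limit_map m f \<in> carrier G \<rightarrow> carrier (null_quotient m)"
proof -
  have m: "\<And>n. m n > 0" using assms by (simp add: sym_map_seq_def)
  interpret q: group_hom "seq_group m" "null_quotient m" "null_class m"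
    by (rule group_hom_null_class[OF m])
  show ?thesis
    unfolding limit_map_def using assms
    by (intro funcsetI q.hom_closed) (auto simp: sym_map_seq_def Pi_iff)
qed

lemma limit_map_hom_iff:
  assumes "group G" "sym_map_seq G m f"
  shows "limit_map m f \<in> hom G (null_quotient m) \<longleftrightarrow>
    (\<forall>g \<in> carrier G. \<forall>h \<in> carrier G.
      (\<lambda>n. hamming_dist (m n) (f n (g \<otimes>\<^bsub>G\<^esub> h)) (f n g \<otimes>\<^bsub>sym_group (m n)\<^esub> f n h)) \<longlonglongrightarrow> 0)"
proof -
  interpret G: group G by fact
  interpret Sn: group "sym_group (m n)" for n by (rule sym_group_is_group)
  have m: "\<And>n. m n > 0" and f: "\<And>n g. g \<in> carrier G \<Longrightarrow> f n g \<in> carrier (sym_group (m n))"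
    using assms by (auto simp: sym_map_seq_def)
  interpret q: group_hom "seq_group m" "null_quotient m" "null_class m"
    by (rule group_hom_null_class[OF m])
  have "limit_map m f (g \<otimes>\<^bsub>G\<^esub> h) = limit_map m f g \<otimes>\<^bsub>null_quotient m\<^esub> limit_map m f h \<longleftrightarrow>
      (\<lambda>n. hamming_dist (m n) (f n (g \<otimes>\<^bsub>G\<^esub> h)) (f n g \<otimes>\<^bsub>sym_group (m n)\<^esub> f n h)) \<longlonglongrightarrow> 0"
    if gh: "g \<in> carrier G" "h \<in> carrier G" for g h
  proof -
    have "limit_map m f g \<otimes>\<^bsub>null_quotient m\<^esub> limit_map m f h =
        null_class m ((\<lambda>n. f n g) \<otimes>\<^bsub>seq_group m\<^esub> (\<lambda>n. f n h))"
      unfolding limit_map_def using f gh by (intro q.hom_mult[symmetric]) auto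
    also have "\<dots> = null_class m (\<lambda>n. f n g \<otimes>\<^bsub>sym_group (m n)\<^esub> f n h)" by (simp add: restrict_def)
    finally show ?thesis
      using null_class_eq_iff[of m, OF m] f gh by (simp add: limit_map_def)
  qed
  with limit_map_closed[OF assms(2)] show ?thesis by (simp add: hom_def)
qed

text \<open>Derivatives pass through the projection to the quotient and through every coordinate
  projection by \<open>mderivs_hom\<close>, so a derivative of the limit map is the class of the
  sequence of derivatives.\<close>

lemma almost_polynomial_iff:
  assumes "group G" "sym_map_seq G m f"
  shows "almost_polynomial G s m f \<longleftrightarrow>
    polynomial_map G (null_quotient m) s (limit_map m f) \<and> limit_map m f \<one>\<^bsub>G\<^esub> = \<one>\<^bsub>null_quotient m\<^esub>"
proof -
  interpret G: group G by fact
  interpret Sn: group "sym_group (m n)" for n by (rule sym_group_is_group)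
  have m: "\<And>n. m n > 0" and f: "\<And>n. f n \<in> carrier G \<rightarrow> carrier (sym_group (m n))"
    using assms by (auto simp: sym_map_seq_def)
  interpret q: group_hom "seq_group m" "null_quotient m" "null_class m"
    by (rule group_hom_null_class[OF m])
  have one: "null_class m (\<lambda>n. \<one>\<^bsub>sym_group (m n)\<^esub>) = \<one>\<^bsub>null_quotient m\<^esub>"
    using q.hom_one by (simp add: restrict_def)
  have null_one: "null_class m \<sigma> = \<one>\<^bsub>null_quotient m\<^esub> \<longleftrightarrow>
      (\<lambda>n. hamming_dist (m n) (\<sigma> n) \<one>\<^bsub>sym_group (m n)\<^esub>) \<longlonglongrightarrow> 0"
    if "\<And>n. \<sigma> n \<in> carrier (sym_group (m n))" for \<sigma>
    using null_class_eq_iff[of m, OF m that Sn.one_closed] one by simp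
  have F: "(\<lambda>g n. f n g) \<in> carrier G \<rightarrow> carrier (seq_group m)"
    using f by auto
  have "mderivs G (null_quotient m) gs (limit_map m f) \<one>\<^bsub>G\<^esub> = \<one>\<^bsub>null_quotient m\<^esub> \<longleftrightarrow>
      (\<lambda>n. hamming_dist (m n) (mderivs G (sym_group (m n)) gs (f n) \<one>\<^bsub>G\<^esub>) \<one>\<^bsub>sym_group (m n)\<^esub>) \<longlonglongrightarrow> 0"
    if gs: "set gs \<subseteq> carrier G" for gs
  proof -
    have "mderivs G (null_quotient m) gs (limit_map m f) \<one>\<^bsub>G\<^esub> =
        null_class m (mderivs G (seq_group m) gs (\<lambda>g n. f n g) \<one>\<^bsub>G\<^esub>)"
      unfolding limit_map_def
      by (rule mderivs_hom[symmetric, OF assms(1) q.G.is_group q.H.is_group q.homh gs F G.one_closed])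
    also have "mderivs G (seq_group m) gs (\<lambda>g n. f n g) \<one>\<^bsub>G\<^esub> =
        (\<lambda>n. mderivs G (sym_group (m n)) gs (f n) \<one>\<^bsub>G\<^esub>)"
    proof
      fix n
      have "(\<lambda>\<sigma>. \<sigma> n) \<in> hom (seq_group m) (sym_group (m n))"
        by (auto simp: hom_def)
      from mderivs_hom[OF assms(1) q.G.is_group Sn.is_group this gs F G.one_closed]
      show "mderivs G (seq_group m) gs (\<lambda>g n. f n g) \<one>\<^bsub>G\<^esub> n = mderivs G (sym_group (m n)) gs (f n) \<one>\<^bsub>G\<^esub>"
        by simp
    qed
    finally show ?thesis
      using null_one[of "\<lambda>n. mderivs G (sym_group (m n)) gs (f n) \<one>\<^bsub>G\<^esub>"]
        mderivs_closed[OF assms(1) Sn.is_group gs f] by auto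
  qed
  moreover have "limit_map m f \<one>\<^bsub>G\<^esub> = \<one>\<^bsub>null_quotient m\<^esub> \<longleftrightarrow>
      (\<lambda>n. hamming_dist (m n) (f n \<one>\<^bsub>G\<^esub>) \<one>\<^bsub>sym_group (m n)\<^esub>) \<longlonglongrightarrow> 0"
    using null_one[of "\<lambda>n. f n \<one>\<^bsub>G\<^esub>"] f by (auto simp: limit_map_def)
  ultimately show ?thesis
    using assms(2) limit_map_closed[OF assms(2)]
    by (auto simp: almost_polynomial_def asymptotically_unital_def polynomial_map_def)
qed

section \<open>Soficity as a local property\<close>

text \<open>Permutations are required for the whole carrier because a product of two elements of
  \<open>F\<close> may leave \<open>F\<close>. The underlying set has an arbitrary type, so that
  models can be built on products.\<close>

definition sofic_model ::
    "('a, 'm) monoid_scheme \<Rightarrow> 'a set \<Rightarrow> real \<Rightarrow> 'v set \<Rightarrow> ('a \<Rightarrow> 'v \<Rightarrow> 'v) \<Rightarrow> bool"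
  where "sofic_model G F \<epsilon> V \<phi> \<longleftrightarrow> (\<forall>g \<in> carrier G. \<phi> g permutes V) \<and>
    (\<forall>g \<in> F. \<forall>h \<in> F. card {v \<in> V. \<phi> (g \<otimes>\<^bsub>G\<^esub> h) v \<noteq> \<phi> g (\<phi> h v)} \<le> \<epsilon> * real (card V)) \<and>
    (\<forall>g \<in> F - {\<one>\<^bsub>G\<^esub>}. card {v \<in> V. \<phi> g v = v} \<le> \<epsilon> * real (card V))"

text \<open>Initial segments of the naturals stand for all finite sets, since the type of a model
  cannot be quantified here; \<open>locally_soficI\<close> restores the free choice of the
  type.\<close>

definition locally_sofic where
  "locally_sofic G \<longleftrightarrow> (\<forall>F \<epsilon>. finite F \<and> F \<subseteq> carrier G \<and> 0 < \<epsilon> \<longrightarrow>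
    (\<exists>n > 0. \<exists>\<phi>. sofic_model G F \<epsilon> {1..n::nat} \<phi>))"

text \<open>Conjugating every permutation with \<open>b\<close> carries the exceptional points of
  one model to those of the other.\<close>

lemma sofic_model_transfer:
  assumes "group G" "F \<subseteq> carrier G" "finite V" "bij_betw b V W" "sofic_model G F \<epsilon> V \<phi>"
  shows "\<exists>\<psi>. sofic_model G F \<epsilon> W \<psi>"
proof -
  interpret G: group G by fact
  have inj: "inj_on b V" and W: "W = b ` V" using assms(4) by (auto simp: bij_betw_def)
  have card_W: "card W = card V" using bij_betw_same_card[OF assms(4)] by simp
  define \<psi> where "\<psi> g = (\<lambda>x. if x \<in> W then b (\<phi> g (inv_into V b x)) else x)" for g
  have perm: "\<phi> g permutes V" if "g \<in> carrier G" for g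
    using assms(5) that by (simp add: sofic_model_def)
  have \<phi>V: "\<phi> g v \<in> V" if "g \<in> carrier G" "v \<in> V" for g v
    using permutes_in_image[OF perm[OF that(1)]] that(2) by simp
  have \<psi>: "\<psi> g (b v) = b (\<phi> g v)" if "v \<in> V" for g v
    using that inj W by (simp add: \<psi>_def)
  have "card {w \<in> W. \<psi> (g \<otimes>\<^bsub>G\<^esub> h) w \<noteq> \<psi> g (\<psi> h w)} \<le> \<epsilon> * card W" if "g \<in> F" "h \<in> F" for g h
  proof -
    have gh: "g \<in> carrier G" "h \<in> carrier G" using that assms(2) by auto
    have "{w \<in> W. \<psi> (g \<otimes>\<^bsub>G\<^esub> h) w \<noteq> \<psi> g (\<psi> h w)} \<subseteq> b ` {v \<in> V. \<phi> (g \<otimes>\<^bsub>G\<^esub> h) v \<noteq> \<phi> g (\<phi> h v)}"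
      using \<psi> \<phi>V gh unfolding W by auto
    then have "card {w \<in> W. \<psi> (g \<otimes>\<^bsub>G\<^esub> h) w \<noteq> \<psi> g (\<psi> h w)} \<le> card {v \<in> V. \<phi> (g \<otimes>\<^bsub>G\<^esub> h) v \<noteq> \<phi> g (\<phi> h v)}"
      by (rule surj_card_le[rotated]) (use assms(3) in auto)
    also have "\<dots> \<le> \<epsilon> * card V" using assms(5) that by (simp add: sofic_model_def)
    finally show ?thesis by (simp add: card_W)
  qed
  moreover have "card {w \<in> W. \<psi> g w = w} \<le> \<epsilon> * card W" if "g \<in> F - {\<one>\<^bsub>G\<^esub>}" for g
  proof -
    have g: "g \<in> carrier G" using that assms(2) by auto
    have "{w \<in> W. \<psi> g w = w} \<subseteq> b ` {v \<in> V. \<phi> g v = v}"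
      using \<psi> \<phi>V[OF g] inj_onD[OF inj] unfolding W by fastforce
    then have "card {w \<in> W. \<psi> g w = w} \<le> card {v \<in> V. \<phi> g v = v}"
      by (rule surj_card_le[rotated]) (use assms(3) in auto)
    also have "\<dots> \<le> \<epsilon> * card V" using assms(5) that by (simp add: sofic_model_def)
    finally show ?thesis by (simp add: card_W)
  qed
  moreover have "\<psi> g permutes W" if "g \<in> carrier G" for g
    unfolding \<psi>_def by (rule permutes_bij_inv_into[OF perm[OF that] assms(4)])
  ultimately show ?thesis unfolding sofic_model_def by blast
qed

lemma locally_soficI:
  assumes "group G"
    and "\<And>F \<epsilon>. finite F \<Longrightarrow> F \<subseteq> carrier G \<Longrightarrow> 0 < \<epsilon> \<Longrightarrow>
      \<exists>(V :: 'v set) \<phi>. finite V \<and> V \<noteq> {} \<and> sofic_model G F \<epsilon> V \<phi>"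
  shows "locally_sofic G"
  unfolding locally_sofic_def
proof (intro allI impI)
  fix F and \<epsilon> :: real assume F: "finite F \<and> F \<subseteq> carrier G \<and> 0 < \<epsilon>"
  then obtain V :: "'v set" and \<phi> where V: "finite V" "V \<noteq> {}" "sofic_model G F \<epsilon> V \<phi>"
    using assms(2)[of F \<epsilon>] by auto
  obtain b where "bij_betw b {1..card V} V"
    using ex_bij_betw_nat_finite_1[OF V(1)] by blast
  then have "bij_betw (inv_into {1..card V} b) V {1..card V}"
    by (rule bij_betw_inv_into)
  from sofic_model_transfer[OF assms(1) _ V(1) this V(3)] F V(1,2)
  show "\<exists>n > 0. \<exists>\<phi>. sofic_model G F \<epsilon> {1..n::nat} \<phi>"
    by (intro exI[of _ "card V"]) (auto simp: card_gt_0_iff)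
qed

section \<open>Equivalence of soficity and local soficity\<close>

lemma hamming_dist_one:
  assumes "n > 0" "\<sigma> \<in> carrier (sym_group n)"
  shows "hamming_dist n \<sigma> \<one>\<^bsub>sym_group n\<^esub> = 1 - card {i \<in> {1..n}. \<sigma> i = i} / n"
proof -
  have "{1..n} = {i \<in> {1..n}. \<sigma> i = i} \<union> {i \<in> {1..n}. \<sigma> i \<noteq> i}" by auto
  then have "card {1..n} = card {i \<in> {1..n}. \<sigma> i = i} + card {i \<in> {1..n}. \<sigma> i \<noteq> i}"
    by (metis (no_types, lifting) card_Un_disjoint disjoint_iff finite_Un finite_atLeastAtMost mem_Collect_eq)
  then have "real (card {i \<in> {1..n}. \<sigma> i = i}) = n - real (card {i \<in> {1..n}. \<sigma> i \<noteq> i})"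
    by simp
  then show ?thesis
    using assms by (simp add: hamming_dist_eq_card_neq sym_group_one field_simps)
qed

text \<open>A finite set \<open>F\<close> involves only finitely many limits, so all the estimates
  hold together at some index, and that term of the sequence is the model.\<close>

lemma sofic_imp_locally_sofic:
  assumes "group G" "sofic G"
  shows "locally_sofic G"
  unfolding locally_sofic_def
proof (intro allI impI)
  fix F and \<epsilon> :: real assume F: "finite F \<and> F \<subseteq> carrier G \<and> 0 < \<epsilon>"
  interpret G: group G by fact
  interpret Sn: group "sym_group n" for n by (rule sym_group_is_group)
  obtain m f where seq: "sym_map_seq G m f"
    and mult: "\<And>g h. g \<in> carrier G \<Longrightarrow> h \<in> carrier G \<Longrightarrow>
        (\<lambda>n. hamming_dist (m n) (f n (g \<otimes>\<^bsub>G\<^esub> h)) (f n g \<otimes>\<^bsub>sym_group (m n)\<^esub> f n h)) \<longlonglongrightarrow> 0"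
    and free: "\<And>g. g \<in> carrier G - {\<one>\<^bsub>G\<^esub>} \<Longrightarrow>
        (\<lambda>n. hamming_dist (m n) (f n g) \<one>\<^bsub>sym_group (m n)\<^esub>) \<longlonglongrightarrow> 1"
    using assms(2) unfolding sofic_def by blast
  have m: "\<And>n. m n > 0" and f: "\<And>n g. g \<in> carrier G \<Longrightarrow> f n g \<in> carrier (sym_group (m n))"
    using seq by (auto simp: sym_map_seq_def)
  have "\<forall>\<^sub>F n in sequentially. \<forall>g \<in> F. \<forall>h \<in> F.
      hamming_dist (m n) (f n (g \<otimes>\<^bsub>G\<^esub> h)) (f n g \<otimes>\<^bsub>sym_group (m n)\<^esub> f n h) < \<epsilon>"
    using F by (intro eventually_ball_finite ballI order_tendstoD(2)[OF mult]) auto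
  moreover have "\<forall>\<^sub>F n in sequentially. \<forall>g \<in> F - {\<one>\<^bsub>G\<^esub>}.
      1 - \<epsilon> < hamming_dist (m n) (f n g) \<one>\<^bsub>sym_group (m n)\<^esub>"
    using F by (intro eventually_ball_finite ballI order_tendstoD(1)[OF free]) auto
  ultimately have "\<forall>\<^sub>F n in sequentially.
      (\<forall>g \<in> F. \<forall>h \<in> F. hamming_dist (m n) (f n (g \<otimes>\<^bsub>G\<^esub> h)) (f n g \<otimes>\<^bsub>sym_group (m n)\<^esub> f n h) < \<epsilon>) \<and>
      (\<forall>g \<in> F - {\<one>\<^bsub>G\<^esub>}. 1 - \<epsilon> < hamming_dist (m n) (f n g) \<one>\<^bsub>sym_group (m n)\<^esub>)"
    by (rule eventually_conj)
  then obtain n where n1: "\<And>g h. g \<in> F \<Longrightarrow> h \<in> F \<Longrightarrow>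
        hamming_dist (m n) (f n (g \<otimes>\<^bsub>G\<^esub> h)) (f n g \<otimes>\<^bsub>sym_group (m n)\<^esub> f n h) < \<epsilon>"
    and n2: "\<And>g. g \<in> F - {\<one>\<^bsub>G\<^esub>} \<Longrightarrow> 1 - \<epsilon> < hamming_dist (m n) (f n g) \<one>\<^bsub>sym_group (m n)\<^esub>"
    using eventually_happens by fastforce
  have "sofic_model G F \<epsilon> {1..m n} (f n)"
    unfolding sofic_model_def
  proof (intro conjI ballI)
    show "f n g permutes {1..m n}" if "g \<in> carrier G" for g
      using f[OF that] by (simp add: sym_group_carrier)
    show "card {v \<in> {1..m n}. f n (g \<otimes>\<^bsub>G\<^esub> h) v \<noteq> f n g (f n h v)} \<le> \<epsilon> * card {1..m n}"
      if "g \<in> F" "h \<in> F" for g h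
    proof -
      have "f n (g \<otimes>\<^bsub>G\<^esub> h) \<in> carrier (sym_group (m n))" using that F by (intro f) auto
      with n1[OF that] m[of n] show ?thesis
        by (simp add: hamming_dist_eq_card_neq sym_group_mult field_simps)
    qed
    show "card {v \<in> {1..m n}. f n g v = v} \<le> \<epsilon> * card {1..m n}" if "g \<in> F - {\<one>\<^bsub>G\<^esub>}" for g
    proof -
      have "f n g \<in> carrier (sym_group (m n))" using that F by (intro f) auto
      with n2[OF that] m[of n] show ?thesis
        by (simp add: hamming_dist_one field_simps)
    qed
  qed
  with m show "\<exists>n > 0. \<exists>\<phi>. sofic_model G F \<epsilon> {1..n::nat} \<phi>" by blast
qed

text \<open>The carrier is exhausted by finite sets, and the model of stage \<open>n\<close> has
  tolerance \<open>1 / Suc n\<close>. Each limit condition involves at most two elements, which are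
  covered from some stage on.\<close>

lemma locally_sofic_imp_sofic:
  assumes "group G" "countable (carrier G)" "locally_sofic G"
  shows "sofic G"
proof -
  interpret G: group G by fact
  interpret Sn: group "sym_group n" for n by (rule sym_group_is_group)
  \<comment> \<open>If the carrier is finite, the surplus indices of the enumeration just return
    some default element of it.\<close>
  define F where "F n = from_nat_into (carrier G) ` {..n}" for n
  have "carrier G \<noteq> {}" by auto
  then have F: "finite (F n)" "F n \<subseteq> carrier G" for n
    by (auto simp: F_def intro: from_nat_into)
  have F_ex: "\<exists>N. \<forall>n \<ge> N. g \<in> F n" if g: "g \<in> carrier G" for g
  proof (intro exI allI impI)
    fix n assume "to_nat_on (carrier G) g \<le> n"
    then show "g \<in> F n"
      unfolding F_def using g assms(2) by (intro image_eqI[of _ _ "to_nat_on (carrier G) g"]) auto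
  qed
  have "\<exists>N \<phi>. 0 < N \<and> sofic_model G (F n) (1 / Suc n) {1..N::nat} \<phi>" for n
    using assms(3) F[of n] unfolding locally_sofic_def by simp
  then obtain m :: "nat \<Rightarrow> nat" and f where m: "\<And>n. 0 < m n"
    and model: "\<And>n. sofic_model G (F n) (1 / Suc n) {1..m n} (f n)"
    by metis
  have f: "f n g \<in> carrier (sym_group (m n))" if "g \<in> carrier G" for n g
    using model that by (simp add: sofic_model_def sym_group_carrier)
  have lim: "(\<lambda>n. 1 / real (Suc n)) \<longlonglongrightarrow> 0"
    using LIMSEQ_inverse_real_of_nat by (simp add: inverse_eq_divide)
  show ?thesis
    unfolding sofic_def
  proof (intro exI conjI ballI)
    show "sym_map_seq G m f" using m f by (auto simp: sym_map_seq_def)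
    fix g assume g: "g \<in> carrier G"
    fix h assume h: "h \<in> carrier G"
    let ?d = "\<lambda>n. hamming_dist (m n) (f n (g \<otimes>\<^bsub>G\<^esub> h)) (f n g \<otimes>\<^bsub>sym_group (m n)\<^esub> f n h)"
    obtain N N' where N: "\<forall>n \<ge> N. g \<in> F n" "\<forall>n \<ge> N'. h \<in> F n"
      using F_ex g h by metis
    have "norm (?d n) \<le> 1 / Suc n" if "n \<ge> max N N'" for n
    proof -
      have "card {v \<in> {1..m n}. f n (g \<otimes>\<^bsub>G\<^esub> h) v \<noteq> f n g (f n h v)} \<le> 1 / Suc n * card {1..m n}"
        using model[of n] N that unfolding sofic_model_def by auto
      then show ?thesis
        using m[of n] f[OF G.m_closed[OF g h], of n]
        by (simp add: hamming_dist_eq_card_neq sym_group_mult divide_le_eq)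
    qed
    then show "?d \<longlonglongrightarrow> 0"
      by (rule Lim_null_comparison[OF eventually_sequentiallyI lim])
  next
    fix g assume g: "g \<in> carrier G - {\<one>\<^bsub>G\<^esub>}"
    let ?d = "\<lambda>n. hamming_dist (m n) (f n g) \<one>\<^bsub>sym_group (m n)\<^esub>"
    obtain N where N: "\<forall>n \<ge> N. g \<in> F n" using F_ex g by blast
    have "norm (?d n - 1) \<le> 1 / Suc n" if "n \<ge> N" for n
    proof -
      have "card {v \<in> {1..m n}. f n g v = v} \<le> 1 / Suc n * card {1..m n}"
        using model[of n] N that g unfolding sofic_model_def by auto
      then show ?thesis
        using m[of n] f[of g n] g by (simp add: hamming_dist_one divide_le_eq)
    qed
    then have "(\<lambda>n. ?d n - 1) \<longlonglongrightarrow> 0"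
      by (rule Lim_null_comparison[OF eventually_sequentiallyI lim])
    then show "?d \<longlonglongrightarrow> 1" by (simp add: LIM_zero_iff)
  qed
qed

text \<open>The complements of \<open>W\<close> and of its image in \<open>C\<close> have equal
  size, so any bijection between them completes \<open>p\<close>. This turns a translation defined
  on most of a finite set into a permutation.\<close>

lemma extend_inj_on_to_permutation:
  assumes "finite C" "W \<subseteq> C" "inj_on p W" "p ` W \<subseteq> C"
  shows "\<exists>\<pi>. \<pi> permutes C \<and> (\<forall>x \<in> W. \<pi> x = p x)"
proof -
  have "card (C - W) = card (C - p ` W)"
    using assms by (simp add: card_Diff_subset card_image finite_subset)
  then obtain q where q: "bij_betw q (C - W) (C - p ` W)"
    using finite_same_card_bij[of "C - W" "C - p ` W"] assms(1) by auto
  define \<pi> where "\<pi> x = (if x \<in> W then p x else if x \<in> C then q x else x)" for x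
  have "bij_betw \<pi> (W \<union> (C - W)) (p ` W \<union> (C - p ` W))"
  proof (rule bij_betw_combine)
    show "bij_betw \<pi> W (p ` W)" using assms(3) by (auto simp: \<pi>_def bij_betw_def inj_on_def)
    have "bij_betw \<pi> (C - W) (C - p ` W) = bij_betw q (C - W) (C - p ` W)"
      by (rule bij_betw_cong) (auto simp: \<pi>_def)
    with q show "bij_betw \<pi> (C - W) (C - p ` W)" by simp
  qed auto
  moreover have "W \<union> (C - W) = C" "p ` W \<union> (C - p ` W) = C" using assms by auto
  ultimately have "\<pi> permutes C"
    using assms(2) by (intro bij_imp_permutes) (auto simp: \<pi>_def)
  then show ?thesis by (intro exI[of _ \<pi>]) (auto simp: \<pi>_def)
qed

section \<open>Extensions by amenable groups\<close>

text \<open>This is Folner's criterion for amenability. Counting the points that leave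
  \<open>C\<close> is enough: in a group, the translate of the finite set \<open>C\<close> misses as
  many points of \<open>C\<close> as leave it.\<close>

definition folner where
  "folner A \<longleftrightarrow> (\<forall>S (\<epsilon>::real). finite S \<and> S \<subseteq> carrier A \<and> 0 < \<epsilon> \<longrightarrow>
    (\<exists>C. finite C \<and> C \<noteq> {} \<and> C \<subseteq> carrier A \<and>
      (\<forall>s \<in> S. card {x \<in> C. s \<otimes>\<^bsub>A\<^esub> x \<notin> C} \<le> \<epsilon> * card C)))"

lemma card_Sigma_le_mult:
  fixes c :: real
  assumes "finite C" "\<And>x. x \<in> C \<Longrightarrow> finite (B x)" "\<And>x. x \<in> C \<Longrightarrow> real (card (B x)) \<le> c"
  shows "real (card (Sigma C B)) \<le> card C * c"
proof -
  have "real (card (Sigma C B)) = (\<Sum>x\<in>C. real (card (B x)))"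
    using assms by (simp add: card_SigmaI)
  also have "\<dots> \<le> card C * c" using sum_bounded_above[of C "\<lambda>x. real (card (B x))" c] assms(3) by simp
  finally show ?thesis .
qed

text \<open>The model is a skew product \<open>C \<times> V\<close> of a Folner set \<open>C\<close>
  of the quotient and a model \<open>V\<close> of the kernel. An element \<open>g\<close> translates
  the base by \<open>h g\<close> and acts on the fibre over \<open>x\<close> through a kernel
  element measuring how \<open>g\<close> moves the chosen lift of \<open>x\<close>. Errors come only
  from the boundary of \<open>C\<close> and from the kernel model.\<close>

theorem (in group_hom) locally_sofic_extension:
  assumes surj: "h ` carrier G = carrier H" and fol: "folner H"
    and ker: "locally_sofic (G\<lparr>carrier := kernel G H h\<rparr>)"
  shows "locally_sofic G"
proof (rule locally_soficI)
  show "group G" by (rule G.is_group)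
  fix F and \<epsilon> :: real
  assume F: "finite F" "F \<subseteq> carrier G" and \<epsilon>: "0 < \<epsilon>"
  \<comment> \<open>Multiplicativity below has three sources of error, each allowed a third of the
    tolerance.\<close>
  define \<delta> where "\<delta> = \<epsilon> / 3"
  have \<delta>: "0 < \<delta>" using \<epsilon> by (simp add: \<delta>_def)
  \<comment> \<open>Products are included because translation by \<open>h (g \<otimes> k)\<close>
    must also keep most of \<open>C\<close> inside \<open>C\<close>.\<close>
  define F2 where "F2 = F \<union> (\<lambda>(x, y). x \<otimes> y) ` (F \<times> F)"
  have F2: "finite F2" "F2 \<subseteq> carrier G" using F by (auto simp: F2_def)
  have F_F2: "g \<in> F2" "g \<in> F \<Longrightarrow> k \<in> F \<Longrightarrow> g \<otimes> k \<in> F2" if "g \<in> F" for g k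
    using that by (auto simp: F2_def)
  obtain C where C: "finite C" "C \<noteq> {}" "C \<subseteq> carrier H"
    and bad: "\<And>g. g \<in> F2 \<Longrightarrow> card {x \<in> C. h g \<otimes>\<^bsub>H\<^esub> x \<notin> C} \<le> \<delta> * card C"
    using fol[unfolded folner_def, rule_format, of "h ` F2" \<delta>] F2 \<delta>
    by (auto simp: image_subset_iff subsetD)
  have "\<exists>\<pi>. \<pi> permutes C \<and> (\<forall>x \<in> {x \<in> C. a \<otimes>\<^bsub>H\<^esub> x \<in> C}. \<pi> x = a \<otimes>\<^bsub>H\<^esub> x)" if a: "a \<in> carrier H" for a
    by (rule extend_inj_on_to_permutation) (use C a in \<open>auto simp: inj_on_def subset_iff\<close>)
  \<comment> \<open>\<open>p a\<close> is left translation by \<open>a\<close> wherever this stays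
    in \<open>C\<close>, completed to a permutation at the remaining points.\<close>
  then obtain p where p: "\<And>a. a \<in> carrier H \<Longrightarrow> p a permutes C"
    and p_eq: "\<And>a x. a \<in> carrier H \<Longrightarrow> x \<in> C \<Longrightarrow> a \<otimes>\<^bsub>H\<^esub> x \<in> C \<Longrightarrow> p a x = a \<otimes>\<^bsub>H\<^esub> x"
    by (simp add: Bex_def) metis
  have pC: "p a x \<in> C" if "a \<in> carrier H" "x \<in> C" for a x
    using permutes_in_image[OF p[OF that(1)]] that(2) by simp
  define r where "r = inv_into (carrier G) h"
  have r: "r x \<in> carrier G" "h (r x) = x" if "x \<in> carrier H" for x
    using that unfolding r_def surj[symmetric] by (auto intro: inv_into_into f_inv_into_f)
  \<comment> \<open>This is the cocycle of the section \<open>r\<close>. Where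
    \<open>p (h g) x\<close> is not the true translate, the expression lies outside the kernel, and
    the default \<open>\<one>\<close> keeps the fibre action a permutation.\<close>
  define c where "c g x = (let k = inv (r (p (h g) x)) \<otimes> g \<otimes> r x in
    if k \<in> kernel G H h then k else \<one>)" for g x
  have c_ker: "c g x \<in> kernel G H h" for g x
    using subgroup.one_closed[OF subgroup_kernel] by (simp add: c_def Let_def)
  have c_eq: "c g x = inv (r (h g \<otimes>\<^bsub>H\<^esub> x)) \<otimes> g \<otimes> r x"
    if "g \<in> carrier G" "x \<in> C" "h g \<otimes>\<^bsub>H\<^esub> x \<in> C" for g x
  proof -
    have x: "x \<in> carrier H" using that C by auto
    then have "inv (r (h g \<otimes>\<^bsub>H\<^esub> x)) \<otimes> g \<otimes> r x \<in> kernel G H h"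
      using that r[OF x] r[of "h g \<otimes>\<^bsub>H\<^esub> x"] by (simp add: kernel_def H.m_assoc)
    then show ?thesis using that p_eq[of "h g" x] by (simp add: c_def)
  qed
  \<comment> \<open>The kernel model has to be accurate on all cocycle values over \<open>C\<close>.
    They form a finite set, so \<open>C\<close> is fixed first and the model chosen
    afterwards.\<close>
  define E where "E = (\<lambda>(g, x). c g x) ` (F2 \<times> C)"
  have E: "finite E" "E \<subseteq> kernel G H h" using F2 C c_ker by (auto simp: E_def)
  have c_E: "c g x \<in> E" if "g \<in> F2" "x \<in> C" for g x using that by (auto simp: E_def)
  obtain N \<psi> where N: "0 < N" and model: "sofic_model (G\<lparr>carrier := kernel G H h\<rparr>) E \<delta> {1..N::nat} \<psi>"
    using ker[unfolded locally_sofic_def, rule_format, of E \<delta>] E \<delta> by auto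
  define V where "V = {1..N}"
  have V: "finite V" "V \<noteq> {}" using N by (auto simp: V_def)
  have \<psi>: "\<psi> k permutes V" if "k \<in> kernel G H h" for k
    using model that by (simp add: sofic_model_def V_def)
  have \<psi>V: "\<psi> k v \<in> V" if "k \<in> kernel G H h" "v \<in> V" for k v
    using permutes_in_image[OF \<psi>[OF that(1)]] that(2) by simp
  define \<phi> where "\<phi> g = (\<lambda>z. if z \<in> C \<times> V then (p (h g) (fst z), \<psi> (c g (fst z)) (snd z)) else z)" for g
  have \<phi>: "\<phi> g (x, v) = (p (h g) x, \<psi> (c g x) v)" if "x \<in> C" "v \<in> V" for g x v
    using that by (simp add: \<phi>_def)
  have perm: "\<phi> g permutes (C \<times> V)" if g: "g \<in> carrier G" for g
  proof (rule bij_imp_permutes)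
    have "inj_on (\<phi> g) (C \<times> V)"
    proof (rule inj_onI, clarify)
      fix x v y w assume xv: "x \<in> C" "v \<in> V" "y \<in> C" "w \<in> V" "\<phi> g (x, v) = \<phi> g (y, w)"
      then have "p (h g) x = p (h g) y" "\<psi> (c g x) v = \<psi> (c g y) w" by (auto simp: \<phi>)
      then show "x = y \<and> v = w"
        using permutes_inj[OF p[of "h g"]] permutes_inj[OF \<psi>[OF c_ker]] g by (auto simp: inj_eq)
    qed
    moreover have "\<phi> g ` (C \<times> V) \<subseteq> C \<times> V"
      using pC \<psi>V c_ker g by (auto simp: \<phi>)
    ultimately show "bij_betw (\<phi> g) (C \<times> V) (C \<times> V)"
      using C V by (simp add: bij_betw_def endo_inj_surj)
  qed (simp add: \<phi>_def)
  have mult: "card {z \<in> C \<times> V. \<phi> (g \<otimes> k) z \<noteq> \<phi> g (\<phi> k z)} \<le> \<epsilon> * card (C \<times> V)"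
    if gk: "g \<in> F" "k \<in> F" for g k
  proof -
    have gc: "g \<in> carrier G" "k \<in> carrier G" using gk F by auto
    define B where "B x = {v \<in> V. \<psi> (c g (p (h k) x) \<otimes> c k x) v \<noteq> \<psi> (c g (p (h k) x)) (\<psi> (c k x) v)}" for x
    have B: "card (B x) \<le> \<delta> * card V" if "x \<in> C" for x
      using model c_E[of k x] c_E[of g "p (h k) x"] F_F2 gk that pC[of "h k" x] gc
      by (simp add: sofic_model_def V_def B_def)
    \<comment> \<open>The product rule can fail over \<open>x\<close> if translation by
      \<open>h k\<close> or by \<open>h (g \<otimes> k)\<close> leaves \<open>C\<close>, or within
      the fibre on the bad set \<open>B x\<close> of the kernel model.\<close>
    define C1 where "C1 = {x \<in> C. h k \<otimes>\<^bsub>H\<^esub> x \<notin> C}"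
    define C2 where "C2 = {x \<in> C. h (g \<otimes> k) \<otimes>\<^bsub>H\<^esub> x \<notin> C}"
    have "{z \<in> C \<times> V. \<phi> (g \<otimes> k) z \<noteq> \<phi> g (\<phi> k z)} \<subseteq> C1 \<times> V \<union> C2 \<times> V \<union> Sigma C B"
    proof (rule subsetI, rule ccontr)
      fix z assume z: "z \<in> {z \<in> C \<times> V. \<phi> (g \<otimes> k) z \<noteq> \<phi> g (\<phi> k z)}"
        and nz: "z \<notin> C1 \<times> V \<union> C2 \<times> V \<union> Sigma C B"
      then obtain x v where xv: "x \<in> C" "v \<in> V" "\<phi> (g \<otimes> k) (x, v) \<noteq> \<phi> g (\<phi> k (x, v))"
        and nB: "(x, v) \<notin> Sigma C B"
        and kx: "h k \<otimes>\<^bsub>H\<^esub> x \<in> C" and gkx: "h (g \<otimes> k) \<otimes>\<^bsub>H\<^esub> x \<in> C"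
        unfolding C1_def C2_def by auto
      have x: "x \<in> carrier H" using xv C by auto
      have assoc: "h (g \<otimes> k) \<otimes>\<^bsub>H\<^esub> x = h g \<otimes>\<^bsub>H\<^esub> (h k \<otimes>\<^bsub>H\<^esub> x)"
        using x gc by (simp add: H.m_assoc)
      have p1: "p (h k) x = h k \<otimes>\<^bsub>H\<^esub> x" using p_eq kx xv gc by simp
      have p2: "p (h g) (h k \<otimes>\<^bsub>H\<^esub> x) = h (g \<otimes> k) \<otimes>\<^bsub>H\<^esub> x"
        using p_eq[of "h g" "h k \<otimes>\<^bsub>H\<^esub> x"] kx gkx gc assoc by simp
      have p3: "p (h (g \<otimes> k)) x = h (g \<otimes> k) \<otimes>\<^bsub>H\<^esub> x"
        using gkx xv gc by (intro p_eq) auto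
      have "c g (h k \<otimes>\<^bsub>H\<^esub> x) \<otimes> c k x =
          inv (r (h (g \<otimes> k) \<otimes>\<^bsub>H\<^esub> x)) \<otimes> g \<otimes> r (h k \<otimes>\<^bsub>H\<^esub> x) \<otimes> (inv (r (h k \<otimes>\<^bsub>H\<^esub> x)) \<otimes> k \<otimes> r x)"
        using c_eq[of g "h k \<otimes>\<^bsub>H\<^esub> x"] c_eq[of k x] kx gkx xv gc assoc by simp
      also have "\<dots> = inv (r (h (g \<otimes> k) \<otimes>\<^bsub>H\<^esub> x)) \<otimes> (g \<otimes> k) \<otimes> r x"
        using r(1)[OF x] r(1)[of "h k \<otimes>\<^bsub>H\<^esub> x"] r(1)[of "h (g \<otimes> k) \<otimes>\<^bsub>H\<^esub> x"] gc x
        by (simp add: G.m_assoc del: hom_mult) (simp add: G.inv_solve_left flip: G.m_assoc)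
      also have "\<dots> = c (g \<otimes> k) x"
        using c_eq[of "g \<otimes> k" x] gkx xv gc by simp
      finally have c3: "c g (p (h k) x) \<otimes> c k x = c (g \<otimes> k) x" by (simp add: p1)
      have "\<psi> (c (g \<otimes> k) x) v = \<psi> (c g (p (h k) x)) (\<psi> (c k x) v)"
        using nB xv by (simp add: B_def c3)
      then have "\<phi> (g \<otimes> k) (x, v) = \<phi> g (\<phi> k (x, v))"
        using xv \<psi>V[OF c_ker, of v k x] kx by (simp add: \<phi> p1 p2 p3 del: hom_mult)
      with xv show False by simp
    qed
    then have "card {z \<in> C \<times> V. \<phi> (g \<otimes> k) z \<noteq> \<phi> g (\<phi> k z)} \<le> card (C1 \<times> V \<union> C2 \<times> V \<union> Sigma C B)"
      by (rule card_mono[rotated]) (use C V in \<open>auto simp: C1_def C2_def B_def\<close>)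
    also have "\<dots> \<le> card (C1 \<times> V) + card (C2 \<times> V) + card (Sigma C B)"
      using card_Un_le[of "C1 \<times> V \<union> C2 \<times> V" "Sigma C B"] card_Un_le[of "C1 \<times> V" "C2 \<times> V"] by linarith
    finally have "card {z \<in> C \<times> V. \<phi> (g \<otimes> k) z \<noteq> \<phi> g (\<phi> k z)} \<le>
        real (card C1) * card V + real (card C2) * card V + real (card (Sigma C B))"
      by (simp add: card_cartesian_product flip: of_nat_mult of_nat_add)
    also have "\<dots> \<le> \<delta> * card C * card V + \<delta> * card C * card V + card C * (\<delta> * card V)"
      using bad[of k] bad[of "g \<otimes> k"] F_F2 gk card_Sigma_le_mult[of C B "\<delta> * card V"] B C V
      by (intro add_mono mult_right_mono) (auto simp: C1_def C2_def B_def)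
    also have "\<dots> = \<epsilon> * card (C \<times> V)"
      by (simp add: card_cartesian_product \<delta>_def)
    finally show ?thesis .
  qed
  have free: "card {z \<in> C \<times> V. \<phi> g z = z} \<le> \<epsilon> * card (C \<times> V)" if g: "g \<in> F - {\<one>}" for g
  proof -
    have gc: "g \<in> carrier G" using g F by auto
    \<comment> \<open>The kernel model bounds fixed points only for cocycle values other than
      \<open>\<one>\<close>. The other fibres get the empty set, and fixed points there are excluded
      by a separate argument.\<close>
    define B where "B x = (if c g x = \<one> then {} else {v \<in> V. \<psi> (c g x) v = v})" for x
    have B: "card (B x) \<le> \<delta> * card V" if "x \<in> C" for x
      using model c_E[of g x] F_F2 g that \<delta> by (simp add: sofic_model_def V_def B_def)
    define C1 where "C1 = {x \<in> C. h g \<otimes>\<^bsub>H\<^esub> x \<notin> C}"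
    have "{z \<in> C \<times> V. \<phi> g z = z} \<subseteq> C1 \<times> V \<union> Sigma C B"
    proof (rule subsetI, rule ccontr)
      fix z assume z: "z \<in> {z \<in> C \<times> V. \<phi> g z = z}" and nz: "z \<notin> C1 \<times> V \<union> Sigma C B"
      then obtain x v where xv: "x \<in> C" "v \<in> V" "\<phi> g (x, v) = (x, v)"
        and nB: "(x, v) \<notin> Sigma C B" and gx: "h g \<otimes>\<^bsub>H\<^esub> x \<in> C"
        unfolding C1_def by auto
      have x: "x \<in> carrier H" using xv C by auto
      have "p (h g) x = x" "\<psi> (c g x) v = v" using xv by (auto simp: \<phi>)
      then have "h g \<otimes>\<^bsub>H\<^esub> x = x" "c g x = \<one>"
        using p_eq[of "h g" x] gx xv gc nB by (auto simp: B_def split: if_splits)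
      \<comment> \<open>If the base point is fixed and the cocycle value is \<open>\<one>\<close>,
        then a conjugate of \<open>g\<close> by the lift \<open>r x\<close> is trivial, hence so is
        \<open>g\<close>.\<close>
      then have "inv (r x) \<otimes> (g \<otimes> r x) = \<one>"
        using c_eq[of g x] gx xv gc r(1)[OF x] by (simp add: G.m_assoc)
      then have "g = \<one>"
        using gc r(1)[OF x] G.inv_solve_left'[of \<one> "r x" "g \<otimes> r x"] by simp
      with g show False by simp
    qed
    then have "card {z \<in> C \<times> V. \<phi> g z = z} \<le> card (C1 \<times> V \<union> Sigma C B)"
      by (rule card_mono[rotated]) (use C V in \<open>auto simp: C1_def B_def\<close>)
    also have "\<dots> \<le> card (C1 \<times> V) + card (Sigma C B)" by (rule card_Un_le)
    finally have "card {z \<in> C \<times> V. \<phi> g z = z} \<le> real (card C1) * card V + real (card (Sigma C B))"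
      by (simp add: card_cartesian_product flip: of_nat_mult of_nat_add)
    also have "\<dots> \<le> \<delta> * card C * card V + card C * (\<delta> * card V)"
      using bad[of g] F_F2 g card_Sigma_le_mult[of C B "\<delta> * card V"] B C V
      by (intro add_mono mult_right_mono) (auto simp: C1_def B_def)
    also have "\<dots> \<le> \<epsilon> * card (C \<times> V)"
      using \<epsilon> by (simp add: card_cartesian_product \<delta>_def)
    finally show ?thesis .
  qed
  have "sofic_model G F \<epsilon> (C \<times> V) \<phi>"
    unfolding sofic_model_def using perm mult free by blast
  then show "\<exists>(W :: ('c \<times> nat) set) \<phi>. finite W \<and> W \<noteq> {} \<and> sofic_model G F \<epsilon> W \<phi>"
    using C V by (intro exI[of _ "C \<times> V"] exI[of _ \<phi>]) auto
qed

section \<open>Folner sets in abelian groups by polynomial growth\<close>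

lemma ex_Suc_le_of_poly_bounded:
  fixes a :: "nat \<Rightarrow> real"
  assumes "0 < \<epsilon>" "0 < a 0" "\<And>n. a n \<le> real (n + 1) ^ k"
  shows "\<exists>n. a (Suc n) \<le> (1 + \<epsilon>) * a n"
proof (rule ccontr)
  \<comment> \<open>If every step grew by more than the factor \<open>1 + \<epsilon>\<close>, the
    sequence would grow exponentially, against the polynomial bound.\<close>
  assume "\<not> ?thesis"
  then have step: "(1 + \<epsilon>) * a n < a (Suc n)" for n by (simp add: not_le)
  have "(1 + \<epsilon>) ^ n * a 0 \<le> a n" for n
  proof (induction n)
    case (Suc n)
    have "(1 + \<epsilon>) ^ Suc n * a 0 = (1 + \<epsilon>) * ((1 + \<epsilon>) ^ n * a 0)" by simp
    also have "\<dots> \<le> (1 + \<epsilon>) * a n" using Suc assms(1) by (intro mult_left_mono) auto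
    also have "\<dots> \<le> a (Suc n)" using step[of n] by simp
    finally show ?case .
  qed simp
  then have le: "(1 + \<epsilon>) ^ n * a 0 \<le> real (n + 1) ^ k" for n
    using assms(3) order_trans by blast
  have "(\<lambda>n. (real n + 1) ^ k / (1 + \<epsilon>) ^ n) \<longlonglongrightarrow> 0"
    using assms(1) by real_asymp
  then have "\<forall>\<^sub>F n in sequentially. (real n + 1) ^ k / (1 + \<epsilon>) ^ n < a 0"
    using assms(2) by (rule order_tendstoD)
  then obtain n where "(real n + 1) ^ k / (1 + \<epsilon>) ^ n < a 0"
    using eventually_happens by fastforce
  then have "(real n + 1) ^ k < (1 + \<epsilon>) ^ n * a 0"
    using assms(1) by (simp add: divide_less_eq mult.commute)
  with le[of n] show False by (simp add: add.commute)
qed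

text \<open>In an abelian group the products of elements of \<open>S\<close> with exponents at most
  \<open>n\<close> number at most \<open>(n + 1) ^ card S\<close>. Polynomial growth forces some
  such box to be almost as large as the next one, and translation by \<open>s\<close> leads from
  each box into the next.\<close>

lemma (in comm_group) folner_comm_group: "folner G"
  unfolding folner_def
proof (intro allI impI)
  fix S and \<epsilon> :: real
  assume "finite S \<and> S \<subseteq> carrier G \<and> 0 < \<epsilon>"
  then have S: "finite S" "S \<subseteq> carrier G" and \<epsilon>: "0 < \<epsilon>" by auto
  \<comment> \<open>Natural exponents suffice, since the condition concerns translations by the
    elements of \<open>S\<close> themselves and not by their inverses.\<close>
  define prd where "prd e = finprod G (\<lambda>s. s [^] e s) S" for e :: "'a \<Rightarrow> nat"
  define B where "B n = prd ` (S \<rightarrow>\<^sub>E {..n})" for n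
  have prd_closed: "prd e \<in> carrier G" for e
    unfolding prd_def using S by (intro finprod_closed) auto
  have fin: "finite (B n)" for n using S by (simp add: B_def finite_PiE)
  have mono: "B n \<subseteq> B (Suc n)" for n
    unfolding B_def by (intro image_mono PiE_mono) auto
  have shift: "s \<otimes> x \<in> B (Suc n)" if s: "s \<in> S" and x: "x \<in> B n" for s x n
  proof -
    obtain e where e: "e \<in> S \<rightarrow>\<^sub>E {..n}" "x = prd e" using x by (auto simp: B_def)
    \<comment> \<open>Translation by \<open>s\<close> raises its exponent by one; commutativity
      brings the extra factor into place.\<close>
    define e' where "e' = e(s := Suc (e s))"
    have e': "e' \<in> S \<rightarrow>\<^sub>E {..Suc n}"
      using e s by (auto simp: e'_def PiE_iff extensional_def le_SucI)
    have sc: "s \<in> carrier G" using s S by auto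
    have "prd e' = finprod G (\<lambda>t. t [^] e t \<otimes> (if s = t then t else \<one>)) S"
      unfolding prd_def using S by (intro finprod_cong) (auto simp: e'_def subset_iff simp_implies_def)
    also have "\<dots> = prd e \<otimes> finprod G (\<lambda>t. if s = t then t else \<one>) S"
      unfolding prd_def using S by (intro finprod_multf) auto
    also have "finprod G (\<lambda>t. if s = t then t else \<one>) S = s"
      using finprod_singleton[OF s S(1), of "\<lambda>t. t"] S by auto
    finally have "s \<otimes> x = prd e'" using e sc prd_closed by (simp add: m_comm)
    with e' show ?thesis by (auto simp: B_def)
  qed
  have "real (card (B n)) \<le> real (n + 1) ^ card S" for n
  proof -
    have "card (B n) \<le> card (S \<rightarrow>\<^sub>E {..n})"
      unfolding B_def using S by (intro card_image_le finite_PiE) auto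
    also have "\<dots> = (n + 1) ^ card S" using S by (simp add: card_PiE)
    finally show ?thesis by (metis of_nat_le_iff of_nat_power)
  qed
  moreover have ne: "B n \<noteq> {}" for n by (simp add: B_def PiE_eq_empty_iff)
  then have "0 < real (card (B 0))" using fin by (simp add: card_gt_0_iff)
  ultimately obtain n where n: "real (card (B (Suc n))) \<le> (1 + \<epsilon>) * card (B n)"
    using ex_Suc_le_of_poly_bounded[of \<epsilon> "\<lambda>n. real (card (B n))" "card S"] \<epsilon> by blast
  have "card {x \<in> B n. s \<otimes> x \<notin> B n} \<le> \<epsilon> * card (B n)" if s: "s \<in> S" for s
  proof -
    have sc: "s \<in> carrier G" using s S by auto
    have Bc: "B n \<subseteq> carrier G" using prd_closed by (auto simp: B_def)
    \<comment> \<open>Translation by \<open>s\<close> sends the points that leave \<open>B n\<close>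
      injectively into \<open>B (Suc n) - B n\<close>, whose size is bounded by the choice of
      \<open>n\<close>.\<close>
    have "card {x \<in> B n. s \<otimes> x \<notin> B n} = card ((\<otimes>) s ` {x \<in> B n. s \<otimes> x \<notin> B n})"
      using sc Bc by (intro card_image[symmetric]) (auto simp: inj_on_def subset_iff)
    also have "\<dots> \<le> card (B (Suc n) - B n)"
      using shift[OF s] fin by (intro card_mono) auto
    also have "\<dots> = card (B (Suc n)) - card (B n)"
      using fin mono by (simp add: card_Diff_subset)
    finally have "card {x \<in> B n. s \<otimes> x \<notin> B n} \<le> real (card (B (Suc n)) - card (B n))" by simp
    also have "\<dots> = real (card (B (Suc n))) - card (B n)"
      using card_mono[OF fin mono] by (simp add: of_nat_diff)
    finally show ?thesis using n by (simp add: algebra_simps)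
  qed
  moreover have "B n \<subseteq> carrier G" using prd_closed by (auto simp: B_def)
  ultimately show "\<exists>C. finite C \<and> C \<noteq> {} \<and> C \<subseteq> carrier G \<and>
      (\<forall>s \<in> S. card {x \<in> C. s \<otimes> x \<notin> C} \<le> \<epsilon> * card C)"
    using fin ne by (intro exI[of _ "B n"]) simp
qed

section \<open>Climbing the derived series\<close>

lemma (in group) locally_sofic_of_derived:
  assumes "locally_sofic (G\<lparr>carrier := derived G (carrier G)\<rparr>)"
  shows "locally_sofic G"
proof -
  let ?D = "derived G (carrier G)"
  interpret D: normal ?D G by (rule derived_self_is_normal)
  interpret Q: comm_group "G Mod ?D" by (rule derived_quot_is_comm_group)
  interpret q: group_hom G "G Mod ?D" "\<lambda>x. ?D #> x"
    using D.r_coset_hom_Mod by (simp add: group_hom_def group_hom_axioms_def is_group Q.is_group)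
  \<comment> \<open>Thus \<open>G\<close> is an extension of its abelianization, which satisfies the
    Folner condition, by the locally sofic group \<open>?D\<close>.\<close>
  have "kernel G (G Mod ?D) (\<lambda>x. ?D #> x) = ?D"
    using coset_join1[OF _ _ D.subgroup_axioms] coset_join2[OF _ D.subgroup_axioms] D.subset
    by (auto simp: kernel_def)
  with assms show ?thesis
    by (intro q.locally_sofic_extension Q.folner_comm_group) (auto simp: carrier_FactGroup)
qed

lemma (in group) locally_sofic_of_derived_series:
  assumes "locally_sofic (G\<lparr>carrier := (derived G ^^ s) (carrier G)\<rparr>)"
  shows "locally_sofic G"
  using assms
proof (induction s)
  case (Suc s)
  let ?D = "(derived G ^^ s) (carrier G)"
  have D: "subgroup ?D G" by (rule exp_of_derived_is_subgroup[OF subgroup_self])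
  interpret K: group "G\<lparr>carrier := ?D\<rparr>" by (rule subgroup_imp_group[OF D])
  \<comment> \<open>The derived subgroup of \<open>?D\<close> is the same whether formed in
    \<open>?D\<close> or in \<open>G\<close>, so the previous result for the group \<open>?D\<close>
    climbs one step of the series.\<close>
  have "derived (G\<lparr>carrier := ?D\<rparr>) ?D = derived G ?D"
    by (rule derived_consistent[OF subset_refl D])
  with Suc.prems have "locally_sofic (G\<lparr>carrier := ?D\<rparr>)"
    by (intro K.locally_sofic_of_derived) simp
  then show ?case by (rule Suc.IH)
qed simp

theorem theorem1p2:
  fixes G :: "('a, 'm) monoid_scheme" and s :: nat
  assumes "s \<ge> 1" and "group G" and "countable (carrier G)"
  shows "(\<exists>m f. polynomial_sofic_approximation G s m f) \<longleftrightarrow> sofic G"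
proof
  interpret G: group G by fact
  assume "sofic G"
  then obtain m f where seq: "sym_map_seq G m f"
    and mult: "\<forall>g \<in> carrier G. \<forall>h \<in> carrier G.
        (\<lambda>n. hamming_dist (m n) (f n (g \<otimes>\<^bsub>G\<^esub> h)) (f n g \<otimes>\<^bsub>sym_group (m n)\<^esub> f n h)) \<longlonglongrightarrow> 0"
    and free: "\<forall>g \<in> carrier G - {\<one>\<^bsub>G\<^esub>}. (\<lambda>n. hamming_dist (m n) (f n g) \<one>\<^bsub>sym_group (m n)\<^esub>) \<longlonglongrightarrow> 1"
    unfolding sofic_def by blast
  interpret q: group_hom "seq_group m" "null_quotient m" "null_class m"
    using seq by (intro group_hom_null_class) (simp add: sym_map_seq_def)
  \<comment> \<open>The given sequence itself serves: its limit map is a homomorphism, hence unital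
    and polynomial of every degree from one on.\<close>
  have hom: "limit_map m f \<in> hom G (null_quotient m)"
    using limit_map_hom_iff[OF assms(2) seq] mult by blast
  then have "almost_polynomial G s m f"
    using almost_polynomial_iff[OF assms(2) seq] polynomial_map_hom[OF assms(2) q.H.is_group hom assms(1)]
      hom_one[OF hom assms(2) q.H.is_group] by simp
  with free show "\<exists>m f. polynomial_sofic_approximation G s m f"
    unfolding polynomial_sofic_approximation_def by blast
next
  interpret G: group G by fact
  assume "\<exists>m f. polynomial_sofic_approximation G s m f"
  then obtain m f where poly: "almost_polynomial G s m f"
    and free: "\<forall>g \<in> carrier G - {\<one>\<^bsub>G\<^esub>}. (\<lambda>n. hamming_dist (m n) (f n g) \<one>\<^bsub>sym_group (m n)\<^esub>) \<longlonglongrightarrow> 1"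
    unfolding polynomial_sofic_approximation_def by blast
  have seq: "sym_map_seq G m f"
    using poly by (simp add: almost_polynomial_def asymptotically_unital_def)
  interpret q: group_hom "seq_group m" "null_quotient m" "null_class m"
    using seq by (intro group_hom_null_class) (simp add: sym_map_seq_def)
  \<comment> \<open>The degree exceeds the index in the derived series by one: degree
    \<open>Suc t\<close> gives multiplicativity on the \<open>t\<close>-th derived subgroup.\<close>
  obtain t where t: "s = Suc t" using assms(1) by (cases s) auto
  define D where "D = (derived G ^^ t) (carrier G)"
  let ?K = "G\<lparr>carrier := D\<rparr>"
  have D: "subgroup D G"
    unfolding D_def by (rule G.exp_of_derived_is_subgroup[OF G.subgroup_self])
  have K: "group ?K" by (rule G.subgroup_imp_group[OF D])
  have D_sub: "D \<subseteq> carrier G" using D subgroup.subset by blast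
  have seq_K: "sym_map_seq ?K m f" using seq D_sub by (auto simp: sym_map_seq_def)
  have "limit_map m f \<in> hom ?K (null_quotient m)"
    using polynomial_map_hom_on_derived[OF assms(2) q.H.is_group] almost_polynomial_iff[OF assms(2) seq] poly
    unfolding t D_def by blast
  \<comment> \<open>Restricted to \<open>D\<close>, the sequence is asymptotically multiplicative,
    and it inherits freeness because the identity is the same.\<close>
  then have "sofic ?K"
    unfolding sofic_def using seq_K limit_map_hom_iff[OF K seq_K] free D_sub
    by (intro exI[of _ m] exI[of _ f]) auto
  then have "locally_sofic ?K" by (rule sofic_imp_locally_sofic[OF K])
  then have "locally_sofic G" unfolding D_def by (rule G.locally_sofic_of_derived_series)
  \<comment> \<open>Countability enters here, to assemble the finite models into a single
    sequence.\<close>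
  then show "sofic G" by (rule locally_sofic_imp_sofic[OF assms(2,3)])
qed

end
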